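(* Let $V$ be a complex vector space with $\dim V=k$, and let $d\ge0$. A basis for $\mathbb{C}[V^{*p}\oplus V^q]^{\mathrm{GL}(V)}_d$ is given by the set of all $(p,q)$-bipartite arc diagrams with total degree $d$ such that no strict nesting contains more than $k$ arcs. Here each such arc diagram is interpreted as the product of contractions in which $f_{ij}$ appears once for each arc $(i^*,j)$.
   Context: $\mathbb{C}[W]_d$ denotes the homogeneous polynomial functions of degree $d$ on $W$, and $\mathbb{C}[W]^H$ the functions with $f(hw)=f(w)$ for all $h\in H$. For $(v_1^*,\dots,v_p^*,v_1,\dots,v_q)\in V^{*p}\oplus V^q$, $f_{ij}(v_1^*,\dots,v_p^*,v_1,\dots,v_q)=v_i^*(v_j)$ for $1\le i\le p$, $1\le j\le q$. A $(p,q)$-bipartite arc diagram is a bipartite multigraph (multiple edges allowed) on vertices $1^*,\dots,p^*,1,\dots,q$, drawn from left to right in this order on a horizontal line, in which every edge (arc) joins a starred vertex $i^*$ to an unstarred vertex $j$. Its total degree is the sum of the vertex degrees (twice the number of arcs, counted with multiplicity). A strict nesting is a set of arcs that are pairwise strictly nested, where $(i^*,j)$ and $(i'^*,j')$ are strictly nested if $i<i'$ and $j>j'$, or $i>i'$ and $j<j'$. *)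

theory Defs
  imports Complex_Main "HOL-Library.Multiset" "HOL-Library.Function_Algebras"
    "HOL-Library.Product_Plus"
begin

text \<open>
  The vector space \<open>V\<close> is a type \<^typ>\<open>'v\<close> with a scalar multiplication \<open>s\<close>. A point of
  \<open>V\<^sup>*\<^sup>p \<oplus> V\<^sup>q\<close> is a pair of families indexed by \<^typ>\<open>nat\<close>, of which only the entries
  \<open>1, \<dots>, p\<close> and \<open>1, \<dots>, q\<close> matter; the others are fixed to be \<open>0\<close>. This makes
  \<open>V\<^sup>*\<^sup>p \<oplus> V\<^sup>q\<close> a linear subspace of the ambient type.
\<close>

type_synonym 'v mixed = "(nat \<Rightarrow> 'v \<Rightarrow> complex) \<times> (nat \<Rightarrow> 'v)"

definition mixed_scale ::
  "(complex \<Rightarrow> 'v \<Rightarrow> 'v) \<Rightarrow> complex \<Rightarrow> 'v mixed \<Rightarrow> 'v mixed" where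
  "mixed_scale s c w = ((\<lambda>i x. c * fst w i x), (\<lambda>j. s c (snd w j)))"

definition mixed_space ::
  "(complex \<Rightarrow> 'v \<Rightarrow> 'v) \<Rightarrow> nat \<Rightarrow> nat \<Rightarrow> 'v::ab_group_add mixed set" where
  "mixed_space s p q =
     {(\<phi>, v). (\<forall>i\<in>{1..p}. Vector_Spaces.linear s (*) (\<phi> i)) \<and> (\<forall>i. i \<notin> {1..p} \<longrightarrow> \<phi> i = 0)
            \<and> (\<forall>j. j \<notin> {1..q} \<longrightarrow> v j = 0)}"

definition GL :: "(complex \<Rightarrow> 'v \<Rightarrow> 'v::ab_group_add) \<Rightarrow> ('v \<Rightarrow> 'v) set" where
  "GL s = {g. Vector_Spaces.linear s s g \<and> bij g}"

definition GL_act :: "('v \<Rightarrow> 'v) \<Rightarrow> 'v mixed \<Rightarrow> 'v mixed" where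
  "GL_act g w = ((\<lambda>i. fst w i \<circ> inv g), (\<lambda>j. g (snd w j)))"

text \<open>
  A function on a subset \<open>W\<close> of a type is represented by its extension by \<open>0\<close> to the whole type,
  so that equality on the type is equality on \<open>W\<close>.
\<close>

definition on_space :: "'w set \<Rightarrow> ('w \<Rightarrow> complex) \<Rightarrow> 'w \<Rightarrow> complex" where
  "on_space W f w = (if w \<in> W then f w else 0)"

definition fun_scale :: "complex \<Rightarrow> ('w \<Rightarrow> complex) \<Rightarrow> 'w \<Rightarrow> complex" where
  "fun_scale c f w = c * f w"

interpretation cfun: vector_space "fun_scale :: complex \<Rightarrow> ('w \<Rightarrow> complex) \<Rightarrow> 'w \<Rightarrow> complex"
  by unfold_locales (auto simp: fun_scale_def fun_eq_iff algebra_simps)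

definition functional_on ::
  "(complex \<Rightarrow> 'w \<Rightarrow> 'w) \<Rightarrow> 'w::ab_group_add set \<Rightarrow> ('w \<Rightarrow> complex) \<Rightarrow> bool" where
  "functional_on s W L \<longleftrightarrow>
     (\<forall>x\<in>W. \<forall>y\<in>W. L (x + y) = L x + L y) \<and> (\<forall>c. \<forall>x\<in>W. L (s c x) = c * L x)"

text \<open>
  Without choosing coordinates, \<open>\<complex>[W]\<^sub>d\<close> is the linear span of the \<open>d\<close>-fold products of linear
  functionals on \<open>W\<close>.
\<close>

definition hom_poly_funs ::
  "(complex \<Rightarrow> 'w \<Rightarrow> 'w) \<Rightarrow> 'w::ab_group_add set \<Rightarrow> nat \<Rightarrow> ('w \<Rightarrow> complex) set" where
  "hom_poly_funs s W d =
     cfun.span {on_space W (\<lambda>w. \<Prod>m<d. L m w) | L. \<forall>m<d. functional_on s W (L m)}"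

definition GL_invariants ::
  "(complex \<Rightarrow> 'v \<Rightarrow> 'v) \<Rightarrow> nat \<Rightarrow> nat \<Rightarrow> nat \<Rightarrow> ('v::ab_group_add mixed \<Rightarrow> complex) set" where
  "GL_invariants s p q d =
     {f \<in> hom_poly_funs (mixed_scale s) (mixed_space s p q) d.
        \<forall>g\<in>GL s. \<forall>w\<in>mixed_space s p q. f (GL_act g w) = f w}"

definition contraction :: "nat \<Rightarrow> nat \<Rightarrow> 'v mixed \<Rightarrow> complex" where
  "contraction i j w = fst w i (snd w j)"

text \<open>An arc \<open>(i\<^sup>*, j)\<close> is the pair \<open>(i, j)\<close>; multiplicities of arcs are those of the multiset.\<close>

type_synonym arc = "nat \<times> nat"

definition bipartite_arc_diagram :: "nat \<Rightarrow> nat \<Rightarrow> arc multiset \<Rightarrow> bool" where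
  "bipartite_arc_diagram p q D \<longleftrightarrow> set_mset D \<subseteq> {1..p} \<times> {1..q}"

definition total_degree :: "nat \<Rightarrow> nat \<Rightarrow> arc multiset \<Rightarrow> nat" where
  "total_degree p q D =
     (\<Sum>i=1..p. size {#a \<in># D. fst a = i#}) + (\<Sum>j=1..q. size {#a \<in># D. snd a = j#})"

definition strictly_nested :: "arc \<Rightarrow> arc \<Rightarrow> bool" where
  "strictly_nested a b \<longleftrightarrow>
     (fst a < fst b \<and> snd a > snd b) \<or> (fst a > fst b \<and> snd a < snd b)"

text \<open>
  The premise \<open>{#a, b#} \<subseteq># N\<close> ranges over the pairs of different arcs of \<open>N\<close>, where parallel copies
  of an arc count as different.
\<close>

definition strict_nesting :: "arc multiset \<Rightarrow> arc multiset \<Rightarrow> bool" where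
  "strict_nesting D N \<longleftrightarrow> N \<subseteq># D \<and> (\<forall>a b. {#a, b#} \<subseteq># N \<longrightarrow> strictly_nested a b)"

definition nesting_bounded_diagrams :: "nat \<Rightarrow> nat \<Rightarrow> nat \<Rightarrow> nat \<Rightarrow> arc multiset set" where
  "nesting_bounded_diagrams k p q d =
     {D. bipartite_arc_diagram p q D \<and> total_degree p q D = d \<and>
         (\<forall>N. strict_nesting D N \<longrightarrow> size N \<le> k)}"

definition diagram_fun ::
  "(complex \<Rightarrow> 'v \<Rightarrow> 'v) \<Rightarrow> nat \<Rightarrow> nat \<Rightarrow> arc multiset \<Rightarrow> 'v::ab_group_add mixed \<Rightarrow> complex" where
  "diagram_fun s p q D =
     on_space (mixed_space s p q) (\<lambda>w. \<Prod>(i, j)\<in>#D. contraction i j w)"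

end

theory Submission
  imports Defs "HOL-Combinatorics.Permutations" "HOL-Computational_Algebra.Polynomial"
begin

text \<open>
  A basis of \<open>V\<close> turns a point of the mixed space into a pair \<open>(X, Y)\<close> of a \<open>p \<times> k\<close> and a \<open>k \<times> q\<close>
  matrix. The contraction \<open>f\<^sub>i\<^sub>j\<close> becomes the entry \<open>(i, j)\<close> of the product \<open>X Y\<close>, and a diagram
  becomes a monomial in these entries. Three facts carry the theorem.

  Every invariant is a combination of diagrams. Invariance says \<open>F(X G, Y) = F(X, G Y)\<close> for
  invertible \<open>G\<close>, hence for all \<open>G\<close>, since both sides are polynomials in \<open>t\<close> along \<open>G + t \<cdot> 1\<close>
  and this matrix is invertible for large \<open>t\<close>. Scalar \<open>G\<close> show that \<open>F\<close> has the same degree \<open>n\<close> in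
  \<open>X\<close> and in \<open>Y\<close>. With coefficients chosen symmetric under permutations of the tensor positions,
  comparing coefficients says that, for fixed row and column indices, they form a \<open>k\<^sup>n \<times> k\<^sup>n\<close>
  matrix that commutes with all tensor powers of \<open>G\<close>, and therefore with everything that commutes
  with the permutations of the \<open>n\<close> positions. By the double centralizer property
  (\<open>double_centralizer_permutations\<close>) the matrix is a combination of permutation matrices, and
  contracting \<open>X\<close> and \<open>Y\<close> along a permutation gives a diagram (\<open>arc_funs_span_invariants\<close>).

  The diagrams with bounded nestings suffice. The minors of \<open>X Y\<close> of size larger than \<open>k\<close> vanish.
  If a diagram has a strict nesting with more than \<open>k\<close> arcs, this rewrites it as a combination of
  diagrams in which the same endpoints are matched differently. Among all matchings the strictly
  nested one has the fewest arcs in each corner \<open>{(i, j). i \<le> s \<and> j \<le> t}\<close>, so the total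
  \<open>corner_sum\<close> of these numbers strictly increases and the rewriting stops
  (\<open>arc_fun_straightening\<close>).

  The diagrams with bounded nestings are independent. Strict nesting is a partial order on arcs, so
  if its chains have at most \<open>k\<close> elements, then colouring each arc by the length of the longest
  chain that ends in it uses \<open>k\<close> colours and gives nested arcs different colours. Expanding
  \<open>f\<^sub>i\<^sub>j = \<Sum>\<^sub>a x\<^sub>i\<^sub>a y\<^sub>a\<^sub>j\<close>, a diagram is the sum over all colourings of one monomial each, and this
  monomial records the endpoints of each colour class. Among all matchings of given endpoints the
  unnested one has the most arcs in each corner. So the monomial of the chosen colouring of a diagram
  \<open>D\<close> occurs in no other diagram whose corner sum is at least that of \<open>D\<close>. In a linear relation,
  the monomial belonging to a diagram with least corner sum therefore cannot cancel
  (\<open>arc_funs_independent\<close>).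
\<close>

section \<open>Monomial functions\<close>

definition monom_fun :: "'x multiset \<Rightarrow> ('x \<Rightarrow> complex) \<Rightarrow> complex" where
  "monom_fun \<mu> z = (\<Prod>v\<in>#\<mu>. z v)"

lemma monom_fun_add: "monom_fun (\<mu> + \<nu>) z = monom_fun \<mu> z * monom_fun \<nu> z"
  by (simp add: monom_fun_def)

lemma monom_fun_image_mset_set:
  "monom_fun (image_mset f (mset_set A)) z = (\<Prod>t\<in>A. z (f t))"
  by (simp add: monom_fun_def prod_unfold_prod_mset image_mset.compositionality comp_def)

lemma monom_fun_mult: "monom_fun \<mu> (\<lambda>v. z v * z' v) = monom_fun \<mu> z * monom_fun \<mu> z'"
  by (simp add: monom_fun_def prod_mset.distrib)

lemma monom_fun_separates:
  assumes "\<mu> \<noteq> \<nu>"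
  shows "\<exists>z. monom_fun \<mu> z \<noteq> monom_fun \<nu> z"
proof -
  obtain v where v: "count \<mu> v \<noteq> count \<nu> v"
    using assms by (auto simp: multiset_eq_iff)
  have eq: "monom_fun \<rho> (\<lambda>u. if u = v then 2 else 1) = 2 ^ count \<rho> v" for \<rho>
    by (induction \<rho>) (auto simp: monom_fun_def)
  have "(2::complex) ^ count \<mu> v \<noteq> 2 ^ count \<nu> v"
  proof
    assume "(2::complex) ^ count \<mu> v = 2 ^ count \<nu> v"
    then have "(of_nat (2 ^ count \<mu> v) :: complex) = of_nat (2 ^ count \<nu> v)" by simp
    then have "(2::nat) ^ count \<mu> v = 2 ^ count \<nu> v" unfolding of_nat_eq_iff .
    then show False using v by simp
  qed
  then show ?thesis by (intro exI[of _ "\<lambda>u. if u = v then 2 else 1"]) (simp add: eq)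
qed

text \<open>
  Evaluation at \<open>\<lambda>v. z' v * z v\<close> multiplies the value of each monomial by its value at \<open>z'\<close>, so
  monomials are distinct characters of a monoid, and Artin's argument applies: subtracting a multiple
  of the relation from its translate by \<open>z'\<close> removes one term.
\<close>

lemma monom_funs_independent:
  assumes "finite S" "\<And>z. (\<Sum>\<mu>\<in>S. c \<mu> * monom_fun \<mu> z) = 0" "\<mu> \<in> S"
  shows "c \<mu> = 0"
  using assms
proof (induction S arbitrary: c \<mu> rule: finite_induct)
  case (insert \<nu> S)
  have z: "c \<nu> * monom_fun \<nu> z + (\<Sum>\<mu>\<in>S. c \<mu> * monom_fun \<mu> z) = 0" for z
    using insert.prems(1)[of z] insert.hyps by simp
  have S0: "c \<mu> = 0" if mu: "\<mu> \<in> S" for \<mu>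
  proof -
    obtain z' where z': "monom_fun \<mu> z' \<noteq> monom_fun \<nu> z'"
      using monom_fun_separates[of \<mu> \<nu>] mu insert.hyps by auto
    \<comment> \<open>the term of \<open>\<nu>\<close> cancels in the difference of the translated and the scaled relation\<close>
    have "(\<Sum>\<mu>\<in>S. (c \<mu> * (monom_fun \<mu> z' - monom_fun \<nu> z')) * monom_fun \<mu> z) = 0" for z
    proof -
      have "(\<Sum>\<mu>\<in>S. (c \<mu> * (monom_fun \<mu> z' - monom_fun \<nu> z')) * monom_fun \<mu> z) =
          (\<Sum>\<mu>\<in>S. c \<mu> * monom_fun \<mu> (\<lambda>v. z' v * z v)) - monom_fun \<nu> z' * (\<Sum>\<mu>\<in>S. c \<mu> * monom_fun \<mu> z)"
        unfolding sum_distrib_left sum_subtractf [symmetric] monom_fun_mult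
        by (rule sum.cong) (simp_all add: algebra_simps)
      also have "\<dots> = (c \<nu> * monom_fun \<nu> (\<lambda>v. z' v * z v) +
            (\<Sum>\<mu>\<in>S. c \<mu> * monom_fun \<mu> (\<lambda>v. z' v * z v))) -
          monom_fun \<nu> z' * (c \<nu> * monom_fun \<nu> z + (\<Sum>\<mu>\<in>S. c \<mu> * monom_fun \<mu> z))"
        unfolding monom_fun_mult[of \<nu>] by (simp add: ring_distribs)
      finally show ?thesis by (simp only: z) simp
    qed
    from insert.IH[OF this \<open>\<mu> \<in> S\<close>] z' show ?thesis by simp
  qed
  have "c \<nu> = 0"
    using z[of "\<lambda>_. 1"] S0 by (simp add: monom_fun_def)
  with S0 insert.prems show ?case by auto
qed simp

text \<open>
  By independence of the monomials, any assignment of numbers \<open>l\<close> to monomials is a well-defined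
  linear functional on polynomial functions. In this form coefficients can be compared without
  collecting the terms that belong to the same monomial.
\<close>

lemma monom_fun_linear_extension:
  assumes H: "finite H" "finite H'"
    and eq: "\<And>z. (\<Sum>h\<in>H. c h * monom_fun (M h) z) = (\<Sum>h\<in>H'. c' h * monom_fun (M' h) z)"
  shows "(\<Sum>h\<in>H. c h * l (M h)) = (\<Sum>h\<in>H'. c' h * l (M' h))"
proof -
  let ?\<Gamma> = "M ` H \<union> M' ` H'"
  define e where "e \<gamma> = (\<Sum>h | h \<in> H \<and> M h = \<gamma>. c h) - (\<Sum>h | h \<in> H' \<and> M' h = \<gamma>. c' h)" for \<gamma>
  have \<Gamma>: "finite ?\<Gamma>" using H by simp
  have group: "(\<Sum>h\<in>H. c h * f (M h)) - (\<Sum>h\<in>H'. c' h * f (M' h)) = (\<Sum>\<gamma>\<in>?\<Gamma>. e \<gamma> * f \<gamma>)" for f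
  proof -
    have "(\<Sum>h\<in>H. c h * f (M h)) = (\<Sum>\<gamma>\<in>?\<Gamma>. \<Sum>h | h \<in> H \<and> M h = \<gamma>. c h * f (M h))"
      by (rule sum.group[symmetric]) (use H \<Gamma> in blast)+
    moreover have "(\<Sum>h\<in>H'. c' h * f (M' h)) = (\<Sum>\<gamma>\<in>?\<Gamma>. \<Sum>h | h \<in> H' \<and> M' h = \<gamma>. c' h * f (M' h))"
      by (rule sum.group[symmetric]) (use H \<Gamma> in blast)+
    ultimately show ?thesis
      unfolding e_def by (simp add: sum_subtractf left_diff_distrib sum_distrib_right)
  qed
  have "e \<gamma> = 0" if "\<gamma> \<in> ?\<Gamma>" for \<gamma>
    by (rule monom_funs_independent[OF \<Gamma> _ that]) (use eq group[of "\<lambda>\<gamma>. monom_fun \<gamma> _"] in simp)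
  then have "(\<Sum>\<gamma>\<in>?\<Gamma>. e \<gamma> * l \<gamma>) = 0" by simp
  then show ?thesis using group[of l] by simp
qed

lemma monom_fun_coefficient_zero:
  assumes "finite H" "\<And>z. (\<Sum>h\<in>H. c h * monom_fun (M h) z) = 0"
  shows "(\<Sum>h | h \<in> H \<and> M h = \<gamma>. c h) = 0"
proof -
  have "(\<Sum>h\<in>H. c h * (if M h = \<gamma> then 1 else 0)) = 0"
    using monom_fun_linear_extension[of H "{}" c M c M "\<lambda>\<mu>. if \<mu> = \<gamma> then 1 else 0"] assms by simp
  moreover have "(\<Sum>h\<in>H. c h * (if M h = \<gamma> then 1 else 0)) = (\<Sum>h\<in>H. if M h = \<gamma> then c h else 0)"
    by (rule sum.cong) auto
  ultimately show ?thesis by (simp only: sum.inter_filter[OF assms(1)])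
qed

text \<open>
  A coefficient function on indices \<open>h\<close> is determined by the polynomial function if it depends on
  the monomial \<open>M h\<close> only.
\<close>

lemma monom_fun_symmetric_coefficient_zero:
  assumes "finite H" "\<And>z. (\<Sum>h\<in>H. c h * monom_fun (M h) z) = 0"
    and sym: "\<And>h h'. h \<in> H \<Longrightarrow> h' \<in> H \<Longrightarrow> M h = M h' \<Longrightarrow> c h = c h'"
    and h: "h \<in> H"
  shows "c h = 0"
proof -
  let ?S = "{h'. h' \<in> H \<and> M h' = M h}"
  have "0 = (\<Sum>h'\<in>?S. c h')"
    using monom_fun_coefficient_zero[OF assms(1,2), of "M h"] by simp
  also have "\<dots> = (\<Sum>h'\<in>?S. c h)"
    by (rule sum.cong) (simp_all add: sym[OF _ h])
  finally have "of_nat (card ?S) * c h = 0" by simp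
  moreover have "finite ?S" "?S \<noteq> {}" using assms(1) h by auto
  then have "card ?S \<noteq> 0" by auto
  ultimately show ?thesis by simp
qed

section \<open>The double centralizer of the permutation operators\<close>

text \<open>
  The ambient function space has infinite dimension, so the finite-dimensional fact that injective
  endomorphisms are surjective is used inside the span of a finite set.
\<close>

lemma cfun_surj_on_span_if_inj:
  fixes \<Psi> :: "('w \<Rightarrow> complex) \<Rightarrow> 'w \<Rightarrow> complex"
  assumes lin: "Vector_Spaces.linear fun_scale fun_scale \<Psi>"
    and S: "finite S" and into: "\<And>X. X \<in> cfun.span S \<Longrightarrow> \<Psi> X \<in> cfun.span S"
    and ker: "\<And>X. X \<in> cfun.span S \<Longrightarrow> \<Psi> X = 0 \<Longrightarrow> X = 0"
    and y: "y \<in> cfun.span S"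
  shows "\<exists>X\<in>cfun.span S. \<Psi> X = y"
proof -
  interpret lin: Vector_Spaces.linear fun_scale fun_scale \<Psi> by (rule lin)
  obtain B where B: "B \<subseteq> S" "cfun.independent B" "S \<subseteq> cfun.span B"
    using cfun.maximal_independent_subset[of S] by metis
  have span_B: "cfun.span B = cfun.span S"
    using B by (metis cfun.span_mono cfun.span_span subset_antisym)
  have fin: "finite B" using B S finite_subset by blast
  have inj: "inj_on \<Psi> (cfun.span B)"
    unfolding lin.inj_on_iff_eq_0[OF cfun.subspace_span] span_B using ker by blast
  have ind: "cfun.independent (\<Psi> ` B)"
    using lin.independent_injective_image[OF B(2) inj] .
  have card: "card (\<Psi> ` B) = card B"
    by (intro card_image inj_on_subset[OF inj] cfun.span_superset)
  have sub: "\<Psi> ` B \<subseteq> cfun.span B"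
    using into cfun.span_superset[of B] unfolding span_B by blast
  have "y \<in> cfun.span (\<Psi> ` B)"
  proof (rule ccontr)
    assume n: "y \<notin> cfun.span (\<Psi> ` B)"
    then have "cfun.independent (insert y (\<Psi> ` B))" using ind by (rule cfun.independent_insertI)
    moreover have "insert y (\<Psi> ` B) \<subseteq> cfun.span B" using sub y span_B by auto
    ultimately have "card (insert y (\<Psi> ` B)) \<le> card B"
      using cfun.independent_span_bound[OF fin] by blast
    moreover have "y \<notin> \<Psi> ` B" using n cfun.span_base by blast
    ultimately show False using card fin by simp
  qed
  then have "y \<in> \<Psi> ` cfun.span B" by (simp add: lin.span_image)
  then show ?thesis by (auto simp: span_B)
qed

text \<open>
  The matrix of the operator by which \<open>\<sigma>\<close> permutes the tensor positions \<open>T\<close>, on the basis of words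
  \<open>T \<rightarrow>\<^sub>E K\<close>.
\<close>

definition perm_matrix ::
  "'t set \<Rightarrow> 'k set \<Rightarrow> ('t \<Rightarrow> 't) \<Rightarrow> ('t \<Rightarrow> 'k) \<times> ('t \<Rightarrow> 'k) \<Rightarrow> complex" where
  "perm_matrix T K \<sigma> = (\<lambda>(u, w). if w \<in> T \<rightarrow>\<^sub>E K \<and> u = w \<circ> \<sigma> then 1 else 0)"

lemma PiE_compose_permutes:
  assumes "\<sigma> permutes T" "w \<in> T \<rightarrow>\<^sub>E K"
  shows "w \<circ> \<sigma> \<in> T \<rightarrow>\<^sub>E K"
  using assms by (auto simp: PiE_iff extensional_def permutes_in_image permutes_not_in)

lemma bij_betw_PiE_compose_permutes:
  assumes "\<sigma> permutes T"
  shows "bij_betw (\<lambda>w. w \<circ> \<sigma>) (T \<rightarrow>\<^sub>E K) (T \<rightarrow>\<^sub>E K)"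
proof (rule bij_betwI[where g = "\<lambda>w. w \<circ> inv \<sigma>"])
  show "(\<lambda>w. w \<circ> \<sigma>) \<in> (T \<rightarrow>\<^sub>E K) \<rightarrow> (T \<rightarrow>\<^sub>E K)" using PiE_compose_permutes[OF assms] by blast
  show "(\<lambda>w. w \<circ> inv \<sigma>) \<in> (T \<rightarrow>\<^sub>E K) \<rightarrow> (T \<rightarrow>\<^sub>E K)"
    using PiE_compose_permutes[OF permutes_inv[OF assms]] by blast
qed (auto simp: comp_assoc permutes_inv_o[OF assms])

lemma sum_fun_apply: "(\<Sum>a\<in>A. F a) x = (\<Sum>a\<in>A. F a x)" for F :: "'a \<Rightarrow> 'b \<Rightarrow> 'c::comm_monoid_add"
  by (induction A rule: infinite_finite_induct) auto

text \<open>
  Let \<open>A\<close> be the span of the permutation matrices and \<open>\<Psi> X = \<Sum>\<^sub>\<sigma> \<langle>X, P\<^sub>\<sigma>\<rangle> P\<^sub>\<sigma>\<close>. As \<open>\<Psi>\<close> is the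
  composition of a linear map with its adjoint, it is injective on \<open>A\<close>, hence \<open>\<Psi> b = 1\<close> for some
  \<open>b \<in> A\<close>. As an operator on matrices \<open>X\<close>, written as a matrix of operators on the columns of \<open>X\<close>,
  \<open>\<Psi>\<close> has entries that commute with the permutations. So \<open>R\<close> commutes with these entries, and
  \<open>R = R \<Psi>(b) = \<Psi>(R b) \<in> A\<close>.
\<close>

theorem double_centralizer_permutations:
  fixes R :: "('t \<Rightarrow> 'k) \<Rightarrow> ('t \<Rightarrow> 'k) \<Rightarrow> complex"
  assumes T: "finite T" and K: "finite K"
    and comm: "\<And>L u w. \<lbrakk>\<And>\<sigma> u w. \<lbrakk>\<sigma> permutes T; u \<in> T \<rightarrow>\<^sub>E K; w \<in> T \<rightarrow>\<^sub>E K\<rbrakk> \<Longrightarrow> L (u \<circ> \<sigma>) (w \<circ> \<sigma>) = L u w;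
        u \<in> T \<rightarrow>\<^sub>E K; w \<in> T \<rightarrow>\<^sub>E K\<rbrakk> \<Longrightarrow>
        (\<Sum>v\<in>T \<rightarrow>\<^sub>E K. L u v * R v w) = (\<Sum>v\<in>T \<rightarrow>\<^sub>E K. R u v * L v w)"
  shows "\<exists>a. \<forall>u\<in>T \<rightarrow>\<^sub>E K. \<forall>w\<in>T \<rightarrow>\<^sub>E K. R u w = (\<Sum>\<sigma> | \<sigma> permutes T. if u = w \<circ> \<sigma> then a \<sigma> else 0)"
proof -
  define U where "U = (T \<rightarrow>\<^sub>E K)"
  define P where "P = {\<sigma>. \<sigma> permutes T}"
  have U: "finite U" unfolding U_def using T K by (simp add: finite_PiE)
  have P: "finite P" unfolding P_def using T by (simp add: finite_permutations)
  have PU: "w \<circ> \<sigma> \<in> U" if "\<sigma> \<in> P" "w \<in> U" for \<sigma> w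
    using that PiE_compose_permutes unfolding U_def P_def by blast
  let ?p = "perm_matrix T K"
  let ?A = "cfun.span (?p ` P)"
  \<comment> \<open>the inner product of \<open>X\<close> with the permutation matrix of \<open>\<sigma>\<close>\<close>
  define tr where "tr X \<sigma> = (\<Sum>v\<in>U. X (v \<circ> \<sigma>, v))" for X :: "('t \<Rightarrow> 'k) \<times> ('t \<Rightarrow> 'k) \<Rightarrow> complex" and \<sigma>
  define \<Psi> where "\<Psi> X = (\<Sum>\<sigma>\<in>P. fun_scale (tr X \<sigma>) (?p \<sigma>))" for X
  have p_eq: "?p \<sigma> (u, w) = (if w \<in> U \<and> u = w \<circ> \<sigma> then 1 else 0)" for \<sigma> u w
    by (simp add: perm_matrix_def U_def)
  have \<Psi>_eq: "\<Psi> X (u, w) = (\<Sum>\<sigma>\<in>P. tr X \<sigma> * (if w \<in> U \<and> u = w \<circ> \<sigma> then 1 else 0))" for X u w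
    by (simp add: \<Psi>_def sum_fun_apply fun_scale_def p_eq)
  have tr_add: "tr (X + Y) \<sigma> = tr X \<sigma> + tr Y \<sigma>" for X Y \<sigma>
    by (simp add: tr_def sum.distrib)
  have tr_scale: "tr (fun_scale c X) \<sigma> = c * tr X \<sigma>" for c X \<sigma>
    by (simp add: tr_def fun_scale_def sum_distrib_left)
  have lin: "Vector_Spaces.linear fun_scale fun_scale \<Psi>"
  proof (unfold_locales, goal_cases)
    case (1 X Y)
    then show ?case by (auto simp: \<Psi>_eq tr_add ring_distribs sum.distrib fun_eq_iff)
  next
    case (2 c X)
    then show ?case by (auto simp: \<Psi>_eq tr_scale fun_scale_def sum_distrib_left mult.assoc fun_eq_iff)
  qed
  have into: "\<Psi> X \<in> ?A" for X
    unfolding \<Psi>_def by (intro cfun.span_sum cfun.span_scale cfun.span_base imageI)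
  have supp: "X (u, w) = 0" if "X \<in> ?A" "u \<notin> U \<or> w \<notin> U" for X u w
    using that(1)
  proof (induction rule: cfun.span_induct_alt)
    case base then show ?case by simp
  next
    case (step c x y)
    then show ?case using that(2) PU by (auto simp: fun_scale_def p_eq split: if_splits)
  qed
  have pair: "(\<Sum>u\<in>U. \<Sum>w\<in>U. X (u, w) * ?p \<sigma> (u, w)) = tr X \<sigma>" if "\<sigma> \<in> P" for X \<sigma>
  proof -
    have "(\<Sum>u\<in>U. \<Sum>w\<in>U. X (u, w) * ?p \<sigma> (u, w)) = (\<Sum>w\<in>U. \<Sum>u\<in>U. if u = w \<circ> \<sigma> then X (u, w) else 0)"
      by (subst sum.swap) (auto simp: p_eq intro!: sum.cong)
    also have "\<dots> = tr X \<sigma>" unfolding tr_def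
      by (intro sum.cong refl) (simp add: sum.delta'[OF U] sum.delta[OF U] PU[OF that])
    finally show ?thesis .
  qed
  have ker: "X = 0" if X: "X \<in> ?A" and "\<Psi> X = 0" for X
  proof -
    \<comment> \<open>\<open>\<langle>\<Psi> X, X\<rangle>\<close> is the sum of the squares \<open>\<bar>\<langle>X, P\<^sub>\<sigma>\<rangle>\<bar>\<^sup>2\<close>, so \<open>\<Psi> X = 0\<close> makes \<open>X\<close> orthogonal to its own span\<close>
    have "(\<Sum>\<sigma>\<in>P. tr X \<sigma> * cnj (tr X \<sigma>)) = (\<Sum>u\<in>U. \<Sum>w\<in>U. \<Psi> X (u, w) * cnj (X (u, w)))"
    proof -
      have "(\<Sum>\<sigma>\<in>P. tr X \<sigma> * cnj (tr X \<sigma>)) =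
          (\<Sum>\<sigma>\<in>P. tr X \<sigma> * (\<Sum>u\<in>U. \<Sum>w\<in>U. cnj (X (u, w)) * ?p \<sigma> (u, w)))"
      proof (rule sum.cong, rule refl)
        fix \<sigma> assume s: "\<sigma> \<in> P"
        have "cnj (tr X \<sigma>) = tr (\<lambda>x. cnj (X x)) \<sigma>" by (simp add: tr_def)
        then show "tr X \<sigma> * cnj (tr X \<sigma>) = tr X \<sigma> * (\<Sum>u\<in>U. \<Sum>w\<in>U. cnj (X (u, w)) * ?p \<sigma> (u, w))"
          using pair[OF s, of "\<lambda>x. cnj (X x)"] by simp
      qed
      also have "\<dots> = (\<Sum>u\<in>U. \<Sum>w\<in>U. \<Sum>\<sigma>\<in>P. tr X \<sigma> * (cnj (X (u, w)) * ?p \<sigma> (u, w)))"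
        by (simp only: sum_distrib_left sum.swap[of _ U P])
      also have "\<dots> = (\<Sum>u\<in>U. \<Sum>w\<in>U. \<Psi> X (u, w) * cnj (X (u, w)))"
        by (intro sum.cong refl) (simp only: \<Psi>_eq p_eq sum_distrib_left sum_distrib_right mult_ac)
      finally show ?thesis .
    qed
    also have "\<dots> = 0" by (simp add: that(2))
    finally have "(\<Sum>\<sigma>\<in>P. tr X \<sigma> * cnj (tr X \<sigma>)) = 0" .
    then have "complex_of_real (\<Sum>\<sigma>\<in>P. (cmod (tr X \<sigma>))\<^sup>2) = 0"
      by (simp only: of_real_sum complex_norm_square)
    then have "(\<Sum>\<sigma>\<in>P. (cmod (tr X \<sigma>))\<^sup>2) = 0" unfolding of_real_eq_0_iff .
    then have tr0: "tr X \<sigma> = 0" if "\<sigma> \<in> P" for \<sigma>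
      using that P by (subst (asm) sum_nonneg_eq_0_iff) auto
    have orth: "(\<Sum>u\<in>U. \<Sum>w\<in>U. X (u, w) * cnj (Y (u, w))) = 0" if "Y \<in> ?A" for Y
      using that
    proof (induction rule: cfun.span_induct_alt)
      case base then show ?case by simp
    next
      case (step c x y)
      then obtain \<sigma> where s: "\<sigma> \<in> P" "x = ?p \<sigma>" by auto
      have "cnj (x (u, w)) = x (u, w)" for u w by (simp add: s p_eq)
      then have "(\<Sum>u\<in>U. \<Sum>w\<in>U. X (u, w) * cnj ((fun_scale c x + y) (u, w))) =
          cnj c * (\<Sum>u\<in>U. \<Sum>w\<in>U. X (u, w) * ?p \<sigma> (u, w)) + (\<Sum>u\<in>U. \<Sum>w\<in>U. X (u, w) * cnj (y (u, w)))"
        by (simp add: fun_scale_def ring_distribs sum.distrib s sum_distrib_left mult_ac)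
      then show ?case using step tr0[OF s(1)] by (simp only: pair[OF s(1)]) simp
    qed
    have "complex_of_real (\<Sum>u\<in>U. \<Sum>w\<in>U. (cmod (X (u, w)))\<^sup>2) = 0"
      using orth[OF X] by (simp only: of_real_sum complex_norm_square)
    then have "(\<Sum>u\<in>U. \<Sum>w\<in>U. (cmod (X (u, w)))\<^sup>2) = 0" unfolding of_real_eq_0_iff .
    then have "X (u, w) = 0" if "u \<in> U" "w \<in> U" for u w
      using that U by (simp add: sum_nonneg_eq_0_iff sum_nonneg)
    with supp[OF X] have "X (u, w) = 0" for u w by blast
    then show ?thesis by (auto simp: fun_eq_iff)
  qed
  have id: "id \<in> P" by (simp add: P_def)
  have "\<exists>b\<in>?A. \<Psi> b = ?p id"
    by (rule cfun_surj_on_span_if_inj[OF lin _ into ker]) (use P id cfun.span_base in blast)+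
  then obtain b where b: "\<Psi> b = ?p id" by blast
  define Rb where "Rb = (\<lambda>(u, w). \<Sum>v\<in>U. R u v * b (v, w))"
  have key: "(\<Sum>\<sigma>\<in>P. if u = w \<circ> \<sigma> then R (v \<circ> \<sigma>) v' else 0) =
      (\<Sum>\<sigma>\<in>P. if v' = v \<circ> \<sigma> then R u (w \<circ> \<sigma>) else 0)"
    if "u \<in> U" "w \<in> U" "v \<in> U" "v' \<in> U" for u w v v'
  proof -
    \<comment> \<open>the entries of \<open>\<Psi>\<close> that link the columns \<open>w\<close> and \<open>v\<close> form an invariant operator\<close>
    define L where "L x y = (\<Sum>\<sigma>\<in>P. if x = w \<circ> \<sigma> \<and> y = v \<circ> \<sigma> then 1 else 0 :: complex)" for x y
    have "L (x \<circ> \<tau>) (y \<circ> \<tau>) = L x y" if t: "\<tau> permutes T" for \<tau> x y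
    proof -
      have eq: "(x \<circ> \<tau> = w \<circ> (\<sigma> \<circ> \<tau>)) = (x = w \<circ> \<sigma>)" for x w :: "'t \<Rightarrow> 'k" and \<sigma>
        by (metis comp_assoc comp_id permutes_inv_o(1)[OF t])
      have "L (x \<circ> \<tau>) (y \<circ> \<tau>) =
          (\<Sum>\<sigma>\<in>P. if x \<circ> \<tau> = w \<circ> (\<sigma> \<circ> \<tau>) \<and> y \<circ> \<tau> = v \<circ> (\<sigma> \<circ> \<tau>) then 1 else 0)"
        unfolding L_def P_def
        by (rule sum_permutations_compose_right[OF t])
      also have "\<dots> = L x y" unfolding L_def eq ..
      finally show ?thesis .
    qed
    then have "(\<Sum>x\<in>U. L u x * R x v') = (\<Sum>x\<in>U. R u x * L x v')"
      using that unfolding U_def by (intro comm) blast+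
    moreover have "(\<Sum>x\<in>U. L u x * R x v') = (\<Sum>\<sigma>\<in>P. if u = w \<circ> \<sigma> then R (v \<circ> \<sigma>) v' else 0)"
    proof -
      have "(\<Sum>x\<in>U. L u x * R x v') =
          (\<Sum>\<sigma>\<in>P. \<Sum>x\<in>U. (if u = w \<circ> \<sigma> \<and> x = v \<circ> \<sigma> then 1 else 0) * R x v')"
        unfolding L_def sum_distrib_right by (rule sum.swap)
      also have "\<dots> = (\<Sum>\<sigma>\<in>P. \<Sum>x\<in>U. if x = v \<circ> \<sigma> then (if u = w \<circ> \<sigma> then R x v' else 0) else 0)"
        by (intro sum.cong refl) auto
      also have "\<dots> = (\<Sum>\<sigma>\<in>P. if u = w \<circ> \<sigma> then R (v \<circ> \<sigma>) v' else 0)"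
        by (intro sum.cong refl) (simp add: sum.delta[OF U] PU that)
      finally show ?thesis .
    qed
    moreover have "(\<Sum>x\<in>U. R u x * L x v') = (\<Sum>\<sigma>\<in>P. if v' = v \<circ> \<sigma> then R u (w \<circ> \<sigma>) else 0)"
    proof -
      have "(\<Sum>x\<in>U. R u x * L x v') =
          (\<Sum>\<sigma>\<in>P. \<Sum>x\<in>U. R u x * (if x = w \<circ> \<sigma> \<and> v' = v \<circ> \<sigma> then 1 else 0))"
        unfolding L_def sum_distrib_left by (rule sum.swap)
      also have "\<dots> = (\<Sum>\<sigma>\<in>P. \<Sum>x\<in>U. if x = w \<circ> \<sigma> then (if v' = v \<circ> \<sigma> then R u x else 0) else 0)"
        by (intro sum.cong refl) auto
      also have "\<dots> = (\<Sum>\<sigma>\<in>P. if v' = v \<circ> \<sigma> then R u (w \<circ> \<sigma>) else 0)"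
        by (intro sum.cong refl) (simp add: sum.delta[OF U] PU that)
      finally show ?thesis .
    qed
    ultimately show ?thesis by simp
  qed
  have "R u w = (\<Sum>\<sigma>\<in>P. if u = w \<circ> \<sigma> then tr Rb \<sigma> else 0)" if u: "u \<in> U" and w: "w \<in> U" for u w
  proof -
    have "R u w = (\<Sum>x\<in>U. if x = w then R u x else 0)"
      by (simp add: sum.delta[OF U] w)
    also have "\<dots> = (\<Sum>x\<in>U. R u x * \<Psi> b (x, w))"
      unfolding b by (intro sum.cong refl) (simp add: p_eq w)
    also have "\<dots> = (\<Sum>x\<in>U. \<Sum>\<sigma>\<in>P. \<Sum>v\<in>U. if x = w \<circ> \<sigma> then R u x * b (v \<circ> \<sigma>, v) else 0)"
      unfolding \<Psi>_eq tr_def sum_distrib_left sum_distrib_right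
      by (intro sum.cong refl) (simp add: w)
    also have "\<dots> = (\<Sum>\<sigma>\<in>P. \<Sum>v\<in>U. \<Sum>x\<in>U. if x = w \<circ> \<sigma> then R u x * b (v \<circ> \<sigma>, v) else 0)"
      by (subst sum.swap, rule sum.cong[OF refl], rule sum.swap)
    also have "\<dots> = (\<Sum>\<sigma>\<in>P. \<Sum>v\<in>U. R u (w \<circ> \<sigma>) * b (v \<circ> \<sigma>, v))"
      by (intro sum.cong refl) (simp add: sum.delta[OF U] PU w)
    also have "\<dots> = (\<Sum>v\<in>U. \<Sum>\<sigma>\<in>P. \<Sum>v'\<in>U. b (v', v) * (if v' = v \<circ> \<sigma> then R u (w \<circ> \<sigma>) else 0))"
      by (subst sum.swap, intro sum.cong refl)
        (simp add: if_distrib[of "(*) _"] sum.delta[OF U] PU mult.commute cong: if_cong)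
    also have "\<dots> = (\<Sum>v\<in>U. \<Sum>v'\<in>U. b (v', v) * (\<Sum>\<sigma>\<in>P. if v' = v \<circ> \<sigma> then R u (w \<circ> \<sigma>) else 0))"
      unfolding sum_distrib_left by (intro sum.cong refl sum.swap)
    also have "\<dots> = (\<Sum>v\<in>U. \<Sum>v'\<in>U. b (v', v) * (\<Sum>\<sigma>\<in>P. if u = w \<circ> \<sigma> then R (v \<circ> \<sigma>) v' else 0))"
      by (intro sum.cong refl) (simp add: key u w)
    also have "\<dots> = (\<Sum>v\<in>U. \<Sum>\<sigma>\<in>P. \<Sum>v'\<in>U. b (v', v) * (if u = w \<circ> \<sigma> then R (v \<circ> \<sigma>) v' else 0))"
      unfolding sum_distrib_left by (intro sum.cong refl sum.swap)
    also have "\<dots> = (\<Sum>\<sigma>\<in>P. if u = w \<circ> \<sigma> then tr Rb \<sigma> else 0)"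
      by (subst sum.swap, intro sum.cong refl) (simp add: tr_def Rb_def mult.commute)
    finally show ?thesis .
  qed
  then show ?thesis unfolding U_def P_def by blast
qed

section \<open>Diagrams as functions of two matrices and corner counts\<close>

text \<open>
  The diagram as a function of the entries \<open>Inl (i, a)\<close> of \<open>X\<close> and \<open>Inr (a, j)\<close> of \<open>Y\<close>. Points are
  functions on all index pairs, of which only those in range matter.
\<close>

definition arc_fun ::
  "nat \<Rightarrow> arc multiset \<Rightarrow> ((nat \<times> nat) + (nat \<times> nat) \<Rightarrow> complex) \<Rightarrow> complex" where
  "arc_fun k D z = (\<Prod>(i, j)\<in>#D. \<Sum>a<k. z (Inl (i, a)) * z (Inr (a, j)))"

definition corner_count :: "arc multiset \<Rightarrow> nat \<Rightarrow> nat \<Rightarrow> nat" where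
  "corner_count D s t = size {#a \<in># D. fst a \<le> s \<and> snd a \<le> t#}"

text \<open>
  A measure of how far the arcs are from being nested. Every corner that can distinguish two diagrams
  on \<open>p\<close> and \<open>q\<close> vertices occurs in the sum.
\<close>

definition corner_sum :: "nat \<Rightarrow> nat \<Rightarrow> arc multiset \<Rightarrow> nat" where
  "corner_sum p q D = (\<Sum>s\<le>p. \<Sum>t\<le>q. corner_count D s t)"

lemma corner_count_add: "corner_count (D + E) s t = corner_count D s t + corner_count E s t"
  by (simp add: corner_count_def)

lemma corner_count_le_size: "corner_count D s t \<le> size D"
  by (simp add: corner_count_def size_mset_mono)

text \<open>
  Inclusion and exclusion over the four corners at a cell recovers the multiplicity of an arc, so a
  diagram is determined by its corner counts.
\<close>

lemma count_eq_corner_count_differences: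
  "count D (Suc i, Suc j) + corner_count D i (Suc j) + corner_count D (Suc i) j = corner_count D (Suc i) (Suc j) + corner_count D i j"
  by (induction D) (auto simp: corner_count_def)

text \<open>
  Corners beyond the grid carry no information, so equality on the range of summation of
  \<open>corner_sum\<close> is equality everywhere.
\<close>

lemma corner_count_truncate:
  assumes "bipartite_arc_diagram p q D"
  shows "corner_count D s t = corner_count D (min s p) (min t q)"
  unfolding corner_count_def using assms
  by (intro arg_cong[where f = size] filter_mset_cong refl) (auto simp: bipartite_arc_diagram_def)

lemma diagram_eqI_corner_count:
  assumes D: "bipartite_arc_diagram p q D" "bipartite_arc_diagram p q D'"
    and eq: "\<And>s t. s \<le> p \<Longrightarrow> t \<le> q \<Longrightarrow> corner_count D s t = corner_count D' s t"
  shows "D = D'"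
proof (rule multiset_eqI)
  fix a :: arc
  obtain i j where a: "a = (i, j)" by force
  have eq': "corner_count D s t = corner_count D' s t" for s t
    using corner_count_truncate[OF D(1), of s t] corner_count_truncate[OF D(2), of s t] eq[of "min s p" "min t q"] by simp
  show "count D a = count D' a"
  proof (cases "i = 0 \<or> j = 0")
    case True
    then have "a \<notin># D" "a \<notin># D'" using D a by (auto simp: bipartite_arc_diagram_def)
    then show ?thesis by (simp add: not_in_iff)
  next
    case False
    then obtain i' j' where "i = Suc i'" "j = Suc j'" by (metis not0_implies_Suc)
    then show ?thesis
      using count_eq_corner_count_differences[of D i' j'] count_eq_corner_count_differences[of D' i' j'] eq' a by simp
  qed
qed

lemma corner_sum_strict_mono:
  assumes D: "bipartite_arc_diagram p q D" "bipartite_arc_diagram p q D'"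
    and le: "\<And>s t. corner_count D s t \<le> corner_count D' s t" and neq: "D \<noteq> D'"
  shows "corner_sum p q D < corner_sum p q D'"
proof -
  obtain s t where st: "s \<le> p" "t \<le> q" "corner_count D s t \<noteq> corner_count D' s t"
    using diagram_eqI_corner_count[OF D] neq by blast
  then have "(\<Sum>t\<le>q. corner_count D s t) < (\<Sum>t\<le>q. corner_count D' s t)"
    by (intro sum_strict_mono_ex1) (use le st in \<open>auto simp: nat_less_le intro!: bexI[of _ t]\<close>)
  then show ?thesis unfolding corner_sum_def
    using st le by (intro sum_strict_mono_ex1) (auto intro!: sum_mono bexI[of _ s])
qed

lemma corner_sum_le: "corner_sum p q D \<le> (p + 1) * (q + 1) * size D"
proof -
  have "corner_sum p q D \<le> (\<Sum>s\<le>p. \<Sum>t\<le>q. size D)"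
    unfolding corner_sum_def by (intro sum_mono corner_count_le_size)
  then show ?thesis by (simp add: algebra_simps)
qed

lemma total_degree_eq:
  assumes "bipartite_arc_diagram p q D"
  shows "total_degree p q D = 2 * size D"
  using assms
proof (induction D)
  case (add x D)
  obtain i j where x: "x = (i, j)" by force
  have "size {#a \<in># add_mset x D. fst a = i'#} = size {#a \<in># D. fst a = i'#} + (if i' = i then 1 else 0)" for i'
    by (simp add: x)
  moreover have "size {#a \<in># add_mset x D. snd a = i'#} = size {#a \<in># D. snd a = i'#} + (if i' = j then 1 else 0)" for i'
    by (simp add: x)
  ultimately show ?case using add
    by (simp add: total_degree_def sum.distrib bipartite_arc_diagram_def x)
qed (simp add: total_degree_def)

lemma size_filter_image_mset: "size {#x \<in># image_mset f D. P x#} = size {#a \<in># D. P (f a)#}"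
  by (induction D) auto

lemma corner_count_plus_rows_above: "corner_count D s t + size {#a \<in># D. fst a \<le> s \<and> t < snd a#} = size {#x \<in># image_mset fst D. x \<le> s#}"
  unfolding size_filter_image_mset by (induction D) (auto simp: corner_count_def)

lemma corner_count_plus_columns_beyond: "corner_count D s t + size {#a \<in># D. s < fst a \<and> snd a \<le> t#} = size {#x \<in># image_mset snd D. x \<le> t#}"
  unfolding size_filter_image_mset by (induction D) (auto simp: corner_count_def)

lemma corner_count_inclusion_exclusion:
  "corner_count D s t + size (image_mset fst D) = size {#x \<in># image_mset fst D. x \<le> s#} +
     size {#x \<in># image_mset snd D. x \<le> t#} + size {#a \<in># D. s < fst a \<and> t < snd a#}"
  unfolding size_filter_image_mset by (induction D) (auto simp: corner_count_def)

lemma pair_subseteq_mset: "a \<in># N \<Longrightarrow> b \<in># N \<Longrightarrow> a \<noteq> b \<Longrightarrow> {#a, b#} \<subseteq># N"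
  by (auto simp: subseteq_mset_def Suc_le_eq)

text \<open>
  By inclusion and exclusion, the corner count and the number of arcs in the opposite corner
  differ by a constant that depends on the endpoints only. A strict nesting cannot have arcs in both
  of these corners, so one of the two numbers is zero and the other as small as possible.
\<close>

lemma corner_count_strict_nesting_le:
  assumes nest: "\<And>a b. {#a, b#} \<subseteq># N \<Longrightarrow> strictly_nested a b"
    and margins: "image_mset fst D = image_mset fst N" "image_mset snd D = image_mset snd N"
  shows "corner_count N s t \<le> corner_count D s t"
proof (cases "corner_count N s t = 0")
  case False
  then obtain a where a: "a \<in># N" "fst a \<le> s" "snd a \<le> t"
    unfolding corner_count_def by (metis (mono_tags, lifting) filter_mset_eq_conv empty_iff set_mset_empty size_empty multiset_nonemptyE mem_Collect_eq set_mset_filter)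
  have "{#b \<in># N. s < fst b \<and> t < snd b#} = {#}"
  proof (rule ccontr)
    assume "{#b \<in># N. s < fst b \<and> t < snd b#} \<noteq> {#}"
    then obtain b where b: "b \<in># N" "s < fst b" "t < snd b"
      by (metis (mono_tags, lifting) multiset_nonemptyE mem_Collect_eq set_mset_filter)
    have "a \<noteq> b" using a b by auto
    then have "{#a, b#} \<subseteq># N" using a b
      by (intro pair_subseteq_mset)
    from nest[OF this] a b show False by (auto simp: strictly_nested_def)
  qed
  then show ?thesis
    using corner_count_inclusion_exclusion[of N s t] corner_count_inclusion_exclusion[of D s t]
    by (simp only: margins size_empty) 
qed simp

text \<open>
  Dual to the case of a strict nesting: an arc in the corner of small rows and large columns and one
  in the corner of large rows and small columns are nested. So one of these corners is empty, and
  all arcs of the rows (or of the columns) up to the bound lie in the corner that is counted.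
\<close>

lemma corner_count_le_unnested:
  assumes chain: "\<And>a b. a \<in># N \<Longrightarrow> b \<in># N \<Longrightarrow> \<not> strictly_nested a b"
    and margins: "image_mset fst D = image_mset fst N" "image_mset snd D = image_mset snd N"
  shows "corner_count D s t \<le> corner_count N s t"
proof (cases "{#a \<in># N. fst a \<le> s \<and> t < snd a#} = {#}")
  case True
  then show ?thesis
    using corner_count_plus_rows_above[of N s t] corner_count_plus_rows_above[of D s t]
    by (simp only: margins True size_empty)
next
  case False
  then obtain a where a: "a \<in># N" "fst a \<le> s" "t < snd a"
    by (metis (mono_tags, lifting) multiset_nonemptyE mem_Collect_eq set_mset_filter)
  have "{#b \<in># N. s < fst b \<and> snd b \<le> t#} = {#}"
  proof (rule ccontr)
    assume "{#b \<in># N. s < fst b \<and> snd b \<le> t#} \<noteq> {#}"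
    then obtain b where b: "b \<in># N" "s < fst b" "snd b \<le> t"
      by (metis (mono_tags, lifting) multiset_nonemptyE mem_Collect_eq set_mset_filter)
    with chain[of a b] a show False by (auto simp: strictly_nested_def)
  qed
  then show ?thesis
    using corner_count_plus_columns_beyond[of N s t] corner_count_plus_columns_beyond[of D s t]
    by (simp only: margins size_empty) 
qed

section \<open>Straightening along vanishing minors\<close>

text \<open>
  Expanding the product over the choices \<open>c\<close> of an inner index for each row, every \<open>c\<close> repeats an
  index because there are fewer than \<open>card S\<close> of them. Swapping two rows with the same inner index
  changes the sign of the permutation and nothing else.
\<close>

lemma minors_of_product_vanish:
  fixes X :: "'a \<Rightarrow> nat \<Rightarrow> complex"
  assumes S: "finite S" and k: "k < card S"
  shows "(\<Sum>\<pi> | \<pi> permutes S. of_int (sign \<pi>) * (\<Prod>a\<in>S. \<Sum>b<k. X a b * Y b (\<pi> a))) = 0"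
proof -
  have "(\<Sum>\<pi> | \<pi> permutes S. of_int (sign \<pi>) * (\<Prod>a\<in>S. \<Sum>b<k. X a b * Y b (\<pi> a))) =
      (\<Sum>\<pi> | \<pi> permutes S. \<Sum>c\<in>S \<rightarrow>\<^sub>E {..<k}.
        (\<Prod>a\<in>S. X a (c a)) * (of_int (sign \<pi>) * (\<Prod>a\<in>S. Y (c a) (\<pi> a))))"
    by (subst prod_sum_PiE[OF S]) (simp_all add: sum_distrib_left prod.distrib mult_ac)
  also have "\<dots> = (\<Sum>c\<in>S \<rightarrow>\<^sub>E {..<k}. (\<Prod>a\<in>S. X a (c a)) *
        (\<Sum>\<pi> | \<pi> permutes S. of_int (sign \<pi>) * (\<Prod>a\<in>S. Y (c a) (\<pi> a))))"
    by (subst sum.swap) (simp add: sum_distrib_left)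
  also have "\<dots> = 0"
  proof (rule sum.neutral, rule ballI)
    fix c assume c: "c \<in> S \<rightarrow>\<^sub>E {..<k}"
    have "\<not> inj_on c S"
      using card_inj_on_le[of c S "{..<k}"] c k by auto
    then obtain a b where ab: "a \<in> S" "b \<in> S" "a \<noteq> b" "c a = c b" by (auto simp: inj_on_def)
    \<comment> \<open>composition with this transposition pairs each term with its negative\<close>
    let ?\<tau> = "Transposition.transpose a b"
    let ?f = "\<lambda>\<pi>. of_int (sign \<pi>) * (\<Prod>a\<in>S. Y (c a) (\<pi> a))"
    have \<tau>: "?\<tau> permutes S" using ab by (simp add: permutes_swap_id)
    have "(\<Sum>\<pi> | \<pi> permutes S. ?f \<pi>) = (\<Sum>\<pi> | \<pi> permutes S. ?f (\<pi> \<circ> ?\<tau>))"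
      by (rule sum_permutations_compose_right[OF \<tau>])
    also have "\<dots> = (\<Sum>\<pi> | \<pi> permutes S. - ?f \<pi>)"
    proof (rule sum.cong, rule refl)
      fix \<pi> assume "\<pi> \<in> {\<pi>. \<pi> permutes S}"
      then have "sign (\<pi> \<circ> ?\<tau>) = - sign \<pi>"
        using sign_compose[of \<pi> ?\<tau>] permutes_imp_permutation[OF S] \<tau> ab by (simp add: sign_swap_id)
      moreover have "(\<Prod>a\<in>S. Y (c a) ((\<pi> \<circ> ?\<tau>) a)) = (\<Prod>a\<in>S. Y (c a) (\<pi> a))"
      proof -
        have "(\<Prod>a\<in>S. Y (c a) (\<pi> a)) = (\<Prod>a\<in>S. Y (c (?\<tau> a)) (\<pi> (?\<tau> a)))"
          using prod.permute[OF \<tau>, of "\<lambda>a. Y (c a) (\<pi> a)"] by (simp add: comp_def)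
        moreover have "c (?\<tau> x) = c x" for x
          using ab by (auto simp: Transposition.transpose_def)
        ultimately show ?thesis by simp
      qed
      ultimately show "?f (\<pi> \<circ> ?\<tau>) = - ?f \<pi>" by simp
    qed
    finally show "(\<Prod>a\<in>S. X a (c a)) * (\<Sum>\<pi> | \<pi> permutes S. ?f \<pi>) = 0"
      by (simp add: sum_negf)
  qed
  finally show ?thesis .
qed

lemma arc_fun_add: "arc_fun k (D + E) z = arc_fun k D z * arc_fun k E z"
  by (simp add: arc_fun_def)

text \<open>
  The term of \<open>\<pi>\<close> in the minor on the rows and columns of \<open>N\<close>, as a diagram.
\<close>

definition rematch :: "(arc \<Rightarrow> arc) \<Rightarrow> arc multiset \<Rightarrow> arc multiset" where
  "rematch \<pi> N = image_mset (\<lambda>a. (fst a, snd (\<pi> a))) N"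

text \<open>
  Parallel arcs are not strictly nested, so a strict nesting is a set of arcs and permutations of
  this set can be applied to it.
\<close>

lemma strict_nesting_eq_mset_set:
  assumes "\<And>a b. {#a, b#} \<subseteq># N \<Longrightarrow> strictly_nested a b"
  shows "N = mset_set (set_mset N)"
proof (rule multiset_eqI)
  fix a
  have "\<not> 2 \<le> count N a"
  proof
    assume "2 \<le> count N a"
    then have "{#a, a#} \<subseteq># N" by (auto simp: subseteq_mset_def)
    from assms[OF this] show False by (simp add: strictly_nested_def)
  qed
  then have "count N a = (if a \<in># N then 1 else 0)"
    using count_eq_zero_iff[of N a] by presburger
  also have "\<dots> = count (mset_set (set_mset N)) a"
    by (simp add: count_mset_set')
  finally show "count N a = count (mset_set (set_mset N)) a" .
qed

lemma strict_nesting_inj: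
  assumes "\<And>a b. {#a, b#} \<subseteq># N \<Longrightarrow> strictly_nested a b"
  shows "inj_on fst (set_mset N)" "inj_on snd (set_mset N)"
proof -
  have "fst a \<noteq> fst b \<and> snd a \<noteq> snd b" if "a \<in># N" "b \<in># N" "a \<noteq> b" for a b
    using assms[OF pair_subseteq_mset[OF that]] by (auto simp: strictly_nested_def)
  then show "inj_on fst (set_mset N)" "inj_on snd (set_mset N)"
    unfolding inj_on_def by blast+
qed

lemma margins_rematch:
  assumes "N = mset_set (set_mset N)" "\<pi> permutes set_mset N"
  shows "image_mset fst (rematch \<pi> N) = image_mset fst N" "image_mset snd (rematch \<pi> N) = image_mset snd N"
proof -
  show "image_mset fst (rematch \<pi> N) = image_mset fst N"
    by (simp add: rematch_def image_mset.compositionality comp_def)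
  have "image_mset \<pi> N = N"
    using permutes_image_mset[OF assms(2)] assms(1) by metis
  then have "image_mset snd N = image_mset snd (image_mset \<pi> N)" by simp
  then show "image_mset snd (rematch \<pi> N) = image_mset snd N"
    by (simp add: rematch_def image_mset.compositionality comp_def)
qed

lemma arc_fun_nesting_relation:
  assumes nest: "\<And>a b. {#a, b#} \<subseteq># N \<Longrightarrow> strictly_nested a b" and k: "k < size N"
  shows "(\<Sum>\<pi> | \<pi> permutes set_mset N. of_int (sign \<pi>) * arc_fun k (rematch \<pi> N) z) = 0"
proof -
  note N = strict_nesting_eq_mset_set[OF nest]
  have "k < card (set_mset N)" using k N by (metis size_mset_set)
  from minors_of_product_vanish[OF finite_set_mset this, of "\<lambda>a b. z (Inl (fst a, b))" "\<lambda>b a. z (Inr (b, snd a))"]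
  have "(\<Sum>\<pi> | \<pi> permutes set_mset N. of_int (sign \<pi>) *
      (\<Prod>a\<in>set_mset N. \<Sum>b<k. z (Inl (fst a, b)) * z (Inr (b, snd (\<pi> a))))) = 0" .
  moreover have "arc_fun k (rematch \<pi> (mset_set (set_mset N))) z =
      (\<Prod>a\<in>set_mset N. \<Sum>b<k. z (Inl (fst a, b)) * z (Inr (b, snd (\<pi> a))))" for \<pi>
    by (simp add: arc_fun_def rematch_def prod_unfold_prod_mset image_mset.compositionality comp_def case_prod_beta)
  ultimately show ?thesis by (simp add: N[symmetric])
qed

lemma rematch_id: "rematch id N = N"
  by (simp add: rematch_def)

lemma rematch_neq:
  assumes nest: "\<And>a b. {#a, b#} \<subseteq># N \<Longrightarrow> strictly_nested a b"
    and \<pi>: "\<pi> permutes set_mset N" "\<pi> \<noteq> id"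
  shows "rematch \<pi> N \<noteq> N"
proof
  assume eq: "rematch \<pi> N = N"
  obtain a where a: "\<pi> a \<noteq> a" using \<pi>(2) by (auto simp: fun_eq_iff)
  then have aN: "a \<in># N" using \<pi>(1) permutes_not_in by metis
  then have "(fst a, snd (\<pi> a)) \<in># rematch \<pi> N" by (auto simp: rematch_def)
  then have "(fst a, snd (\<pi> a)) \<in># N" by (simp add: eq)
  then have "(fst a, snd (\<pi> a)) = a"
    using strict_nesting_inj(1)[OF nest] aN by (auto simp: inj_on_def)
  then have "snd (\<pi> a) = snd a" by (metis snd_conv)
  moreover have "\<pi> a \<in># N" using aN \<pi>(1) permutes_in_image by metis
  ultimately show False using a aN strict_nesting_inj(2)[OF nest] by (auto simp: inj_on_def)
qed

lemma bipartite_arc_diagram_iff_margins: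
  "bipartite_arc_diagram p q D \<longleftrightarrow>
     set_mset (image_mset fst D) \<subseteq> {1..p} \<and> set_mset (image_mset snd D) \<subseteq> {1..q}"
  by (auto simp: bipartite_arc_diagram_def image_subset_iff mem_Times_iff)

text \<open>
  A nesting \<open>N\<close> of more than \<open>k\<close> arcs is the identity term of a vanishing minor. Solving for it
  replaces \<open>N\<close> by its other matchings, which have a larger corner sum; the corner sum is bounded
  in terms of the number of arcs, which does not change.
\<close>

theorem arc_fun_straightening:
  assumes "bipartite_arc_diagram p q D" "total_degree p q D = d"
  shows "arc_fun k D \<in> cfun.span (arc_fun k ` nesting_bounded_diagrams k p q d)"
  using assms
proof (induction "(p + 1) * (q + 1) * d - corner_sum p q D" arbitrary: D rule: less_induct)
  case less
  show ?case
  proof (cases "D \<in> nesting_bounded_diagrams k p q d")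
    case True
    then show ?thesis by (intro cfun.span_base) auto
  next
    case False
    then obtain N where N: "N \<subseteq># D" "\<And>a b. {#a, b#} \<subseteq># N \<Longrightarrow> strictly_nested a b" "k < size N"
      using less.prems by (auto simp: nesting_bounded_diagrams_def strict_nesting_def not_le)
    obtain E where D: "D = N + E" using N(1) by (auto simp: mset_subset_eq_exists_conv)
    note NS = strict_nesting_eq_mset_set[OF N(2)]
    let ?P = "{\<pi>. \<pi> permutes set_mset N}"
    have P: "finite ?P" by (simp add: finite_permutations)
    have "arc_fun k D = - (\<Sum>\<pi>\<in>?P - {id}. fun_scale (of_int (sign \<pi>)) (arc_fun k (rematch \<pi> N + E)))"
    proof
      fix z
      have "0 = (\<Sum>\<pi>\<in>?P. of_int (sign \<pi>) * arc_fun k (rematch \<pi> N) z) * arc_fun k E z"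
        by (simp add: arc_fun_nesting_relation[OF N(2,3)])
      also have "\<dots> = (\<Sum>\<pi>\<in>?P. of_int (sign \<pi>) * arc_fun k (rematch \<pi> N + E) z)"
        by (simp add: sum_distrib_right arc_fun_add mult.assoc)
      also have "\<dots> = arc_fun k D z + (\<Sum>\<pi>\<in>?P - {id}. of_int (sign \<pi>) * arc_fun k (rematch \<pi> N + E) z)"
        by (subst sum.remove[OF P, of id]) (simp_all add: rematch_id D)
      finally show "arc_fun k D z =
          (- (\<Sum>\<pi>\<in>?P - {id}. fun_scale (of_int (sign \<pi>)) (arc_fun k (rematch \<pi> N + E)))) z"
        by (simp add: sum_fun_apply fun_scale_def eq_neg_iff_add_eq_0)
    qed
    also have "\<dots> \<in> cfun.span (arc_fun k ` nesting_bounded_diagrams k p q d)"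
    proof (intro cfun.span_neg cfun.span_sum cfun.span_scale)
      fix \<pi> assume "\<pi> \<in> ?P - {id}"
      then have \<pi>: "\<pi> permutes set_mset N" "\<pi> \<noteq> id" by auto
      let ?D = "rematch \<pi> N + E"
      note margins = margins_rematch[OF NS \<pi>(1)]
      have bip: "bipartite_arc_diagram p q ?D"
        using less.prems(1) by (simp add: bipartite_arc_diagram_iff_margins D margins del: set_image_mset)
      have size: "size ?D = size D" unfolding D by (simp add: rematch_def)
      then have deg: "total_degree p q ?D = d"
        using less.prems total_degree_eq[OF bip] total_degree_eq[OF less.prems(1)] by simp
      have "corner_sum p q D < corner_sum p q ?D"
      proof (rule corner_sum_strict_mono[OF less.prems(1) bip])
        show "corner_count D s t \<le> corner_count ?D s t" for s t
          unfolding D corner_count_add using corner_count_strict_nesting_le[OF N(2) margins] by simp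
        show "D \<noteq> ?D" unfolding D using rematch_neq[OF N(2) \<pi>] by simp
      qed
      moreover have "corner_sum p q ?D \<le> (p + 1) * (q + 1) * d"
      proof (rule order_trans[OF corner_sum_le mult_le_mono2])
        show "size ?D \<le> d" using total_degree_eq[OF bip] deg by simp
      qed
      ultimately show "arc_fun k ?D \<in> cfun.span (arc_fun k ` nesting_bounded_diagrams k p q d)"
        by (intro less.hyps bip deg) linarith
    qed
    finally show ?thesis .
  qed
qed

section \<open>Linear independence\<close>

text \<open>
  The colour of an arc is the largest size of a strict nesting of which it is the arc with the
  largest row index, minus one. A strict nesting can be extended by any arc that is nested
  with its last arc and has a larger row index, so nested arcs get different colours.
\<close>

lemma nesting_bounded_colouring:
  assumes D: "D \<in> nesting_bounded_diagrams k p q d"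
  shows "\<exists>col. (\<forall>a\<in>#D. col a < k) \<and>
    (\<forall>a\<in>#D. \<forall>b\<in>#D. col a = col b \<longrightarrow> \<not> strictly_nested a b)"
proof -
  \<comment> \<open>the strict nestings among the arcs of \<open>D\<close> that end in \<open>a\<close>\<close>
  define \<C> where "\<C> a = {C. C \<subseteq> set_mset D \<and> (\<forall>x\<in>C. \<forall>y\<in>C. x \<noteq> y \<longrightarrow> strictly_nested x y) \<and>
     a \<in> C \<and> (\<forall>x\<in>C. fst x \<le> fst a)}" for a
  have fin: "finite (\<C> a)" for a
    by (rule finite_subset[of _ "Pow (set_mset D)"]) (auto simp: \<C>_def)
  have bound: "card C \<le> k" if "C \<in> \<C> a" for C a
  proof -
    have C: "C \<subseteq> set_mset D" "\<And>x y. x \<in> C \<Longrightarrow> y \<in> C \<Longrightarrow> x \<noteq> y \<Longrightarrow> strictly_nested x y"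
      using that by (auto simp: \<C>_def)
    have "finite C" using C(1) finite_subset by blast
    have "strict_nesting D (mset_set C)"
      unfolding strict_nesting_def
    proof (intro conjI allI impI)
      show "mset_set C \<subseteq># D"
        using C(1) \<open>finite C\<close> by (auto simp: subseteq_mset_def count_mset_set' Suc_le_eq)
      fix x y assume xy: "{#x, y#} \<subseteq># mset_set C"
      have "x \<noteq> y"
      proof
        assume "x = y"
        then have "2 \<le> count (mset_set C) x"
          using mset_subset_eq_count[OF xy, of x] by simp
        then show False by (simp add: count_mset_set' split: if_splits)
      qed
      moreover have "x \<in> C" "y \<in> C"
        using set_mset_mono[OF xy] \<open>finite C\<close> by auto
      ultimately show "strictly_nested x y" using C(2) by blast
    qed
    with D have "size (mset_set C) \<le> k" by (auto simp: nesting_bounded_diagrams_def)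
    then show ?thesis by simp
  qed
  have single: "{a} \<in> \<C> a" if "a \<in># D" for a using that by (auto simp: \<C>_def)
  define depth where "depth a = Max (card ` \<C> a)" for a
  have depth_ge: "card C \<le> depth a" if "C \<in> \<C> a" for C a
    unfolding depth_def using fin that by simp
  have depth_in: "\<exists>C\<in>\<C> a. card C = depth a" if "a \<in># D" for a
  proof -
    have "Max (card ` \<C> a) \<in> card ` \<C> a"
      by (rule Max_in) (use fin single[OF that] in blast)+
    then show ?thesis by (auto simp: depth_def)
  qed
  have less: "depth a < depth b" if ab: "a \<in># D" "b \<in># D" "fst a < fst b" "snd b < snd a" for a b
  proof -
    obtain C where C: "C \<in> \<C> a" "card C = depth a" using depth_in[OF ab(1)] by blast
    have nest: "fst x < fst b \<and> snd b < snd x" if "x \<in> C" for x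
    proof (cases "x = a")
      case False
      with C(1) that have "strictly_nested x a" "fst x \<le> fst a" by (auto simp: \<C>_def)
      then show ?thesis using ab by (auto simp: strictly_nested_def)
    qed (use ab in auto)
    then have "insert b C \<in> \<C> b"
      using C(1) ab(2) by (auto simp: \<C>_def strictly_nested_def less_imp_le)
    from depth_ge[OF this] have "card (insert b C) \<le> depth b" .
    moreover have "finite C" using C(1) finite_subset by (auto simp: \<C>_def)
    moreover have "b \<notin> C" using nest[of b] by auto
    ultimately show ?thesis using C(2) by simp
  qed
  have pos: "0 < depth a" if "a \<in># D" for a
    using depth_ge[OF single[OF that]] by simp
  show ?thesis
  proof (intro exI[of _ "\<lambda>a. depth a - 1"] conjI ballI impI)
    fix a assume a: "a \<in># D"
    then obtain C where "C \<in> \<C> a" "card C = depth a" using depth_in by blast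
    with bound[of C a] pos[OF a] show "depth a - 1 < k" by simp
    fix b assume b: "b \<in># D" "depth a - 1 = depth b - 1"
    then have "depth a = depth b" using pos[OF a] pos[OF b(1)] by simp
    then show "\<not> strictly_nested a b"
      using less[OF a b(1)] less[OF b(1) a] by (auto simp: strictly_nested_def)
  qed
qed

lemma mset_enumeration: "\<exists>A. D = image_mset A (mset_set {..<size D})"
proof -
  obtain l where l: "mset l = D" using ex_mset by blast
  have "image_mset ((!) l) (mset_set {..<length l}) = mset (map ((!) l) [0..<length l])"
    by (simp add: atLeast0LessThan)
  also have "\<dots> = D" by (simp only: map_nth l)
  finally have "image_mset ((!) l) (mset_set {..<size D}) = D" using size_mset[of l] unfolding l by simp
  then show ?thesis by metis
qed

text \<open>
  The monomial that a colouring \<open>u\<close> selects when the product over the arcs \<open>A t\<close> of the sums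
  \<open>\<Sum>\<^sub>a x\<^sub>i\<^sub>a y\<^sub>a\<^sub>j\<close> is expanded.
\<close>

definition colour_monomial ::
  "('t \<Rightarrow> arc) \<Rightarrow> ('t \<Rightarrow> nat) \<Rightarrow> 't multiset \<Rightarrow> ((nat \<times> nat) + (nat \<times> nat)) multiset" where
  "colour_monomial A u T = image_mset (\<lambda>t. Inl (fst (A t), u t)) T + image_mset (\<lambda>t. Inr (u t, snd (A t))) T"

lemma arc_fun_colouring_expansion:
  assumes "finite T"
  shows "arc_fun k (image_mset A (mset_set T)) z =
    (\<Sum>u\<in>T \<rightarrow>\<^sub>E {..<k}. monom_fun (colour_monomial A u (mset_set T)) z)"
proof -
  have "arc_fun k (image_mset A (mset_set T)) z =
      (\<Prod>t\<in>T. \<Sum>a<k. z (Inl (fst (A t), a)) * z (Inr (a, snd (A t))))"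
    by (simp add: arc_fun_def prod_unfold_prod_mset image_mset.compositionality comp_def case_prod_beta)
  also have "\<dots> = (\<Sum>u\<in>T \<rightarrow>\<^sub>E {..<k}. \<Prod>t\<in>T. z (Inl (fst (A t), u t)) * z (Inr (u t, snd (A t))))"
    by (rule prod_sum_PiE) (use assms in auto)
  finally show ?thesis
    by (simp add: colour_monomial_def monom_fun_add monom_fun_image_mset_set prod.distrib)
qed

text \<open>
  The monomial of a colouring determines the endpoints of the arcs of each colour, but not how they
  are matched.
\<close>

lemma colour_class_margins:
  "image_mset fst (image_mset A {#t \<in># T. u t = b#}) =
     image_mset (fst \<circ> projl) {#v \<in># colour_monomial A u T. isl v \<and> snd (projl v) = b#}"
  "image_mset snd (image_mset A {#t \<in># T. u t = b#}) =
     image_mset (snd \<circ> projr) {#v \<in># colour_monomial A u T. \<not> isl v \<and> fst (projr v) = b#}"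
proof -
  show "image_mset fst (image_mset A {#t \<in># T. u t = b#}) =
      image_mset (fst \<circ> projl) {#v \<in># colour_monomial A u T. isl v \<and> snd (projl v) = b#}"
    by (induction T) (simp_all add: colour_monomial_def)
  show "image_mset snd (image_mset A {#t \<in># T. u t = b#}) =
      image_mset (snd \<circ> projr) {#v \<in># colour_monomial A u T. \<not> isl v \<and> fst (projr v) = b#}"
    by (induction T) (simp_all add: colour_monomial_def)
qed

lemma corner_count_colour_classes:
  fixes k :: nat
  assumes "\<forall>t\<in>#T. u t < k"
  shows "corner_count (image_mset A T) s t = (\<Sum>b<k. corner_count (image_mset A {#t \<in># T. u t = b#}) s t)"
  using assms
proof (induction T)
  case (add x T)
  let ?e = "corner_count {#A x#} s t"
  have "(\<Sum>b<k. corner_count (image_mset A {#t \<in># add_mset x T. u t = b#}) s t) =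
      (\<Sum>b<k. (if b = u x then ?e else 0) + corner_count (image_mset A {#t \<in># T. u t = b#}) s t)"
    by (rule sum.cong) (auto simp: corner_count_def)
  also have "\<dots> = ?e + (\<Sum>b<k. corner_count (image_mset A {#t \<in># T. u t = b#}) s t)"
    using add.prems by (simp add: sum.distrib)
  finally show ?case using add corner_count_add[of "{#A x#}" "image_mset A T" s t] by simp
qed (simp add: corner_count_def)

text \<open>
  If two coloured diagrams have the same monomial, their colour classes have the same endpoints, and
  the unnested matching of these has the largest corner counts.
\<close>

lemma corner_count_le_of_colour_monomial_eq:
  fixes k :: nat
  assumes u: "\<forall>t\<in>#T. u t < k" "\<forall>t\<in>#T'. u' t < k"
    and chain: "\<And>a b. a \<in># T \<Longrightarrow> b \<in># T \<Longrightarrow> u a = u b \<Longrightarrow> \<not> strictly_nested (A a) (A b)"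
    and eq: "colour_monomial A' u' T' = colour_monomial A u T"
  shows "corner_count (image_mset A' T') s t \<le> corner_count (image_mset A T) s t"
  unfolding corner_count_colour_classes[OF u(1)] corner_count_colour_classes[OF u(2)]
proof (rule sum_mono, rule corner_count_le_unnested)
  fix b
  show "\<not> strictly_nested x y"
    if xy: "x \<in># image_mset A {#t \<in># T. u t = b#}" "y \<in># image_mset A {#t \<in># T. u t = b#}" for x y
  proof -
    obtain a c where "a \<in># T" "c \<in># T" "u a = b" "u c = b" "x = A a" "y = A c" using xy by auto
    then show ?thesis using chain[of a c] by simp
  qed
qed (simp_all only: colour_class_margins eq)

text \<open>
  The coefficient of a monomial in a linear relation is a sum over pairs of a diagram and a colouring.
  For the monomial that belongs to a diagram of least corner sum, coloured without nestings inside a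
  colour class, only pairs with this diagram contribute, all with the same coefficient.
\<close>

theorem arc_funs_independent:
  assumes S: "finite S" "S \<subseteq> nesting_bounded_diagrams k p q d"
    and zero: "\<And>z. (\<Sum>D\<in>S. c D * arc_fun k D z) = 0" and D: "D \<in> S"
  shows "c D = 0"
proof (rule ccontr)
  assume "c D \<noteq> 0"
  have bip: "bipartite_arc_diagram p q D" if "D \<in> S" for D
    using that S(2) by (auto simp: nesting_bounded_diagrams_def)
  define n where "n = d div 2"
  have size: "size D = n" if "D \<in> S" for D
    using total_degree_eq[OF bip[OF that]] that S(2) by (auto simp: n_def nesting_bounded_diagrams_def)
  define A where "A D = (SOME A. D = image_mset A (mset_set {..<n}))" for D :: "arc multiset"
  have A: "image_mset (A D) (mset_set {..<n}) = D" if "D \<in> S" for D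
  proof -
    have "\<exists>A. D = image_mset A (mset_set {..<n})" using mset_enumeration[of D] size[OF that] by simp
    from someI_ex[OF this] show ?thesis unfolding A_def by (rule sym)
  qed
  let ?U = "{..<n} \<rightarrow>\<^sub>E {..<k}"
  have U: "finite ?U" by (simp add: finite_PiE)
  define M where "M = (\<lambda>(D, u). colour_monomial (A D) u (mset_set {..<n}))"
  let ?H = "S \<times> ?U"
  have "(\<Sum>h\<in>?H. c (fst h) * monom_fun (M h) z) = (\<Sum>D\<in>S. c D * arc_fun k D z)" for z
  proof -
    have "(\<Sum>h\<in>?H. c (fst h) * monom_fun (M h) z) =
        (\<Sum>(D, u)\<in>?H. c D * monom_fun (colour_monomial (A D) u (mset_set {..<n})) z)"
      by (rule sum.cong) (simp_all add: M_def case_prod_beta)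
    also have "\<dots> = (\<Sum>D\<in>S. \<Sum>u\<in>?U. c D * monom_fun (colour_monomial (A D) u (mset_set {..<n})) z)"
      by (rule sum.cartesian_product[symmetric])
    also have "\<dots> = (\<Sum>D\<in>S. c D * arc_fun k (image_mset (A D) (mset_set {..<n})) z)"
      by (simp add: arc_fun_colouring_expansion sum_distrib_left)
    finally show ?thesis by (simp add: A)
  qed
  then have coeff: "(\<Sum>h | h \<in> ?H \<and> M h = \<gamma>. c (fst h)) = 0" for \<gamma>
    by (intro monom_fun_coefficient_zero) (use S(1) U zero in auto)
  \<comment> \<open>the monomial of a diagram occurs in no other diagram of at least its corner sum, so a minimal one is isolated\<close>
  have "\<exists>D0. (D0 \<in> S \<and> c D0 \<noteq> 0) \<and>
      (\<forall>D. D \<in> S \<and> c D \<noteq> 0 \<longrightarrow> corner_sum p q D0 \<le> corner_sum p q D)"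
    by (rule ex_has_least_nat[of _ D]) (use D \<open>c D \<noteq> 0\<close> in simp)
  then obtain D0 where D0: "D0 \<in> S" "c D0 \<noteq> 0" and
    min: "\<And>D. D \<in> S \<Longrightarrow> c D \<noteq> 0 \<Longrightarrow> corner_sum p q D0 \<le> corner_sum p q D"
    by metis
  have "D0 \<in> nesting_bounded_diagrams k p q d" using D0(1) S(2) by (rule subsetD[rotated])
  from nesting_bounded_colouring[OF this]
  obtain col where col: "\<And>a. a \<in># D0 \<Longrightarrow> col a < k"
    "\<And>a b. a \<in># D0 \<Longrightarrow> b \<in># D0 \<Longrightarrow> col a = col b \<Longrightarrow> \<not> strictly_nested a b"
    by metis
  have A0: "A D0 t \<in># D0" if "t < n" for t
  proof -
    have "A D0 t \<in># image_mset (A D0) (mset_set {..<n})" using that by simp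
    then show ?thesis by (simp only: A[OF D0(1)])
  qed
  define u0 where "u0 = restrict (\<lambda>t. col (A D0 t)) {..<n}"
  have u0: "u0 \<in> ?U" using col(1) A0 by (auto simp: u0_def)
  define \<gamma> where "\<gamma> = M (D0, u0)"
  have only: "D = D0" if D: "D \<in> S" "c D \<noteq> 0" and u: "u \<in> ?U" "M (D, u) = \<gamma>" for D u
  proof (rule ccontr)
    assume neq: "D \<noteq> D0"
    have "corner_count (image_mset (A D) (mset_set {..<n})) s t \<le> corner_count (image_mset (A D0) (mset_set {..<n})) s t" for s t
    proof (rule corner_count_le_of_colour_monomial_eq)
      show "colour_monomial (A D) u (mset_set {..<n}) = colour_monomial (A D0) u0 (mset_set {..<n})"
        using u(2) by (simp add: \<gamma>_def M_def)
      show "\<forall>t\<in>#mset_set {..<n}. u0 t < k" "\<forall>t\<in>#mset_set {..<n}. u t < k"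
        using u0 u(1) by (auto simp: PiE_iff)
      show "\<not> strictly_nested (A D0 a) (A D0 b)"
        if "a \<in># mset_set {..<n}" "b \<in># mset_set {..<n}" "u0 a = u0 b" for a b
        using that col(2)[OF A0 A0, of a b] by (simp add: u0_def)
    qed
    then have "corner_sum p q D < corner_sum p q D0"
      using corner_sum_strict_mono[OF bip[OF D(1)] bip[OF D0(1)]] neq by (simp add: A D D0)
    with min[OF D] show False by simp
  qed
  let ?G = "{h. h \<in> ?H \<and> M h = \<gamma>}" and ?GD = "{h. h \<in> ?H \<and> M h = \<gamma> \<and> fst h = D0}"
  have fin: "finite ?G"
    by (rule finite_subset[OF _ finite_cartesian_product[OF S(1) U]]) blast
  have "of_nat (card ?GD) * c D0 = (\<Sum>h\<in>?GD. c D0)" by (simp only: sum_constant)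
  also have "\<dots> = (\<Sum>h\<in>?GD. c (fst h))" by (rule sum.cong[OF refl]) (simp only: mem_Collect_eq)
  also have "\<dots> = (\<Sum>h\<in>?G. c (fst h))"
  proof (rule sum.mono_neutral_left[OF fin])
    show "\<forall>h\<in>?G - ?GD. c (fst h) = 0"
    proof
      fix h assume h: "h \<in> ?G - ?GD"
      obtain D u where Du: "h = (D, u)" by force
      with h have "D \<in> S" "u \<in> ?U" "M (D, u) = \<gamma>" "D \<noteq> D0" by simp_all
      then show "c (fst h) = 0" using only[of D u] unfolding Du fst_conv by metis
    qed
  qed blast
  also have "\<dots> = 0" by (rule coeff)
  finally have "of_nat (card ?GD) * c D0 = 0" .
  then have "card ?GD = 0" using D0(2) by (simp only: mult_eq_0_iff of_nat_eq_0_iff) simp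
  moreover have "finite ?GD" by (rule finite_subset[OF _ fin]) blast
  ultimately have "?GD = {}" by (simp only: card_0_eq)
  moreover have "(D0, u0) \<in> ?GD" using D0(1) u0 by (simp add: \<gamma>_def)
  ultimately show False by blast
qed

section \<open>Tensor coefficients of polynomials in two matrices\<close>

text \<open>
  The substitution \<open>(X, Y) \<mapsto> (X G, Y)\<close>. An invariant cannot distinguish it from
  \<open>(X, Y) \<mapsto> (X, G Y)\<close>, which needs no inverse of \<open>G\<close> and so makes sense for every matrix.
\<close>

definition row_action ::
  "nat \<Rightarrow> (nat \<times> nat \<Rightarrow> complex) \<Rightarrow> ((nat \<times> nat) + (nat \<times> nat) \<Rightarrow> complex) \<Rightarrow> (nat \<times> nat) + (nat \<times> nat) \<Rightarrow> complex" where
  "row_action k G z = case_sum (\<lambda>(i, a). \<Sum>b<k. z (Inl (i, b)) * G (b, a)) (\<lambda>v. z (Inr v))"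

definition col_action ::
  "nat \<Rightarrow> (nat \<times> nat \<Rightarrow> complex) \<Rightarrow> ((nat \<times> nat) + (nat \<times> nat) \<Rightarrow> complex) \<Rightarrow> (nat \<times> nat) + (nat \<times> nat) \<Rightarrow> complex" where
  "col_action k G z = case_sum (\<lambda>v. z (Inl v)) (\<lambda>(a, j). \<Sum>b<k. G (a, b) * z (Inr (b, j)))"

definition coordinates :: "nat \<Rightarrow> nat \<Rightarrow> nat \<Rightarrow> ((nat \<times> nat) + (nat \<times> nat)) set" where
  "coordinates k p q = ({1..p} \<times> {..<k}) <+> ({..<k} \<times> {1..q})"

text \<open>
  The monomial with a factor \<open>x(I t, u t)\<close> and a factor \<open>y(w t, J t)\<close> for each position \<open>t < n\<close>.
  The outer indices \<open>I\<close>, \<open>J\<close> and the inner indices \<open>u\<close>, \<open>w\<close> are kept apart, since base change acts on the inner ones only.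
\<close>

definition tensor_monomial ::
  "nat \<Rightarrow> (nat \<Rightarrow> nat) \<Rightarrow> (nat \<Rightarrow> nat) \<Rightarrow> (nat \<Rightarrow> nat) \<Rightarrow> (nat \<Rightarrow> nat) \<Rightarrow> ((nat \<times> nat) + (nat \<times> nat)) multiset" where
  "tensor_monomial n I J u w =
     image_mset (\<lambda>t. Inl (I t, u t)) (mset_set {..<n}) + image_mset (\<lambda>t. Inr (w t, J t)) (mset_set {..<n})"

lemma monom_fun_tensor_monomial:
  "monom_fun (tensor_monomial n I J u w) z = (\<Prod>t<n. z (Inl (I t, u t))) * (\<Prod>t<n. z (Inr (w t, J t)))"
  by (simp add: tensor_monomial_def monom_fun_add monom_fun_image_mset_set)

lemma PiE_eq_compose:
  assumes \<sigma>: "\<sigma> permutes T" and fg: "f \<in> T \<rightarrow>\<^sub>E A" "g \<in> T \<rightarrow>\<^sub>E A" and eq: "\<And>t. t \<in> T \<Longrightarrow> f t = g (\<sigma> t)"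
  shows "f = g \<circ> \<sigma>"
  using fg(1) PiE_compose_permutes[OF \<sigma> fg(2)] by (rule PiE_ext) (simp add: eq)

lemma image_mset_pair_eq_imp_permutes:
  assumes T: "finite T" and f: "f \<in> T \<rightarrow>\<^sub>E A" "f' \<in> T \<rightarrow>\<^sub>E A" and g: "g \<in> T \<rightarrow>\<^sub>E B" "g' \<in> T \<rightarrow>\<^sub>E B"
    and eq: "image_mset (\<lambda>t. (f' t, g' t)) (mset_set T) = image_mset (\<lambda>t. (f t, g t)) (mset_set T)"
  shows "\<exists>\<sigma>. \<sigma> permutes T \<and> f' = f \<circ> \<sigma> \<and> g' = g \<circ> \<sigma>"
proof -
  obtain \<sigma> where \<sigma>: "\<sigma> permutes T" "\<forall>t\<in>T. (f' t, g' t) = (f (\<sigma> t), g (\<sigma> t))"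
    using image_mset_eq_implies_permutes[OF T eq] by auto
  then show ?thesis
    using PiE_eq_compose[OF \<sigma>(1) f(2,1)] PiE_eq_compose[OF \<sigma>(1) g(2,1)] by blast
qed

lemma tensor_monomial_parts:
  "image_mset (\<lambda>t. (I t, u t)) (mset_set {..<n}) = image_mset projl (filter_mset isl (tensor_monomial n I J u w))"
  "image_mset (\<lambda>t. (w t, J t)) (mset_set {..<n}) = image_mset projr (filter_mset (\<lambda>v. \<not> isl v) (tensor_monomial n I J u w))"
  by (simp_all add: tensor_monomial_def filter_mset_image_mset image_mset.compositionality comp_def)

text \<open>
  The positions of the factors from \<open>X\<close> and of those from \<open>Y\<close> may be permuted independently.
\<close>

lemma tensor_monomial_eq_imp_permutes:
  assumes I: "I \<in> {..<n} \<rightarrow>\<^sub>E A" "I' \<in> {..<n} \<rightarrow>\<^sub>E A" and J: "J \<in> {..<n} \<rightarrow>\<^sub>E B" "J' \<in> {..<n} \<rightarrow>\<^sub>E B"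
    and u: "u \<in> {..<n} \<rightarrow>\<^sub>E K" "u' \<in> {..<n} \<rightarrow>\<^sub>E K" and w: "w \<in> {..<n} \<rightarrow>\<^sub>E K" "w' \<in> {..<n} \<rightarrow>\<^sub>E K"
    and eq: "tensor_monomial n I' J' u' w' = tensor_monomial n I J u w"
  shows "\<exists>\<sigma> \<tau>. \<sigma> permutes {..<n} \<and> \<tau> permutes {..<n} \<and>
    I' = I \<circ> \<sigma> \<and> u' = u \<circ> \<sigma> \<and> w' = w \<circ> \<tau> \<and> J' = J \<circ> \<tau>"
proof -
  have "image_mset (\<lambda>t. (I' t, u' t)) (mset_set {..<n}) = image_mset (\<lambda>t. (I t, u t)) (mset_set {..<n})"
    unfolding tensor_monomial_parts(1)[of I' u' n J' w'] tensor_monomial_parts(1)[of I u n J w] eq ..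
  from image_mset_pair_eq_imp_permutes[OF finite_lessThan I u this]
  obtain \<sigma> where "\<sigma> permutes {..<n}" "I' = I \<circ> \<sigma>" "u' = u \<circ> \<sigma>" by blast
  moreover have "image_mset (\<lambda>t. (w' t, J' t)) (mset_set {..<n}) = image_mset (\<lambda>t. (w t, J t)) (mset_set {..<n})"
    unfolding tensor_monomial_parts(2)[of w' J' n I' u'] tensor_monomial_parts(2)[of w J n I u] eq ..
  from image_mset_pair_eq_imp_permutes[OF finite_lessThan w J this]
  obtain \<tau> where "\<tau> permutes {..<n}" "w' = w \<circ> \<tau>" "J' = J \<circ> \<tau>" by blast
  ultimately show ?thesis by blast
qed

lemma tensor_monomial_compose:
  assumes "\<sigma> permutes {..<n}" "\<tau> permutes {..<n}"
  shows "tensor_monomial n (I \<circ> \<sigma>) (J \<circ> \<tau>) (u \<circ> \<sigma>) (w \<circ> \<tau>) = tensor_monomial n I J u w"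
proof -
  have "image_mset (f \<circ> \<rho>) (mset_set {..<n}) = image_mset f (mset_set {..<n})"
    if "\<rho> permutes {..<n}" for f :: "nat \<Rightarrow> (nat \<times> nat) + (nat \<times> nat)" and \<rho>
    using permutes_image_mset[OF that] by (metis image_mset.compositionality)
  from this[OF assms(1), of "\<lambda>t. Inl (I t, u t)"] this[OF assms(2), of "\<lambda>t. Inr (w t, J t)"]
  show ?thesis by (simp add: tensor_monomial_def comp_def)
qed

definition tensor_power :: "nat \<Rightarrow> (nat \<times> nat \<Rightarrow> complex) \<Rightarrow> (nat \<Rightarrow> nat) \<Rightarrow> (nat \<Rightarrow> nat) \<Rightarrow> complex" where
  "tensor_power n G u w = (\<Prod>t<n. G (u t, w t))"

lemma tensor_power_compose:
  assumes "\<sigma> permutes {..<n}"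
  shows "tensor_power n G (u \<circ> \<sigma>) (w \<circ> \<sigma>) = tensor_power n G u w"
  unfolding tensor_power_def using prod.permute[OF assms, of "\<lambda>t. G (u t, w t)"] by (simp add: comp_def)

text \<open>
  The entries of \<open>tensor_power n G\<close> are monomials in \<open>G\<close>, and two entries are the same monomial if
  and only if a permutation of positions relates them. An operator that is invariant under
  permutations is therefore obtained from the tensor powers by a linear functional on polynomials
  in \<open>G\<close>, and applying this functional to the commutation relation proves the claim.
\<close>

lemma commutes_with_symmetric_operators:
  fixes R :: "(nat \<Rightarrow> nat) \<Rightarrow> (nat \<Rightarrow> nat) \<Rightarrow> complex"
  fixes n k :: nat
  defines "U \<equiv> {..<n} \<rightarrow>\<^sub>E {..<k}"
  assumes comm: "\<And>G u w. u \<in> U \<Longrightarrow> w \<in> U \<Longrightarrow>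
      (\<Sum>v\<in>U. tensor_power n G u v * R v w) = (\<Sum>v\<in>U. R u v * tensor_power n G v w)"
    and inv: "\<And>\<sigma> u w. \<sigma> permutes {..<n} \<Longrightarrow> u \<in> U \<Longrightarrow> w \<in> U \<Longrightarrow> L (u \<circ> \<sigma>) (w \<circ> \<sigma>) = L u w"
    and uw: "u \<in> U" "w \<in> U"
  shows "(\<Sum>v\<in>U. L u v * R v w) = (\<Sum>v\<in>U. R u v * L v w)"
proof -
  define M where "M u v = image_mset (\<lambda>t. (u t, v t)) (mset_set {..<n})" for u v :: "nat \<Rightarrow> nat"
  have monom: "monom_fun (M u v) G = tensor_power n G u v" for u v G
    by (simp add: M_def tensor_power_def monom_fun_image_mset_set)
  have U: "finite U" unfolding U_def by (simp add: finite_PiE)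
  \<comment> \<open>the functional on polynomials in \<open>G\<close> that sends tensor powers to \<open>L\<close>\<close>
  define l where "l \<mu> = (SOME x. \<exists>u\<in>U. \<exists>v\<in>U. M u v = \<mu> \<and> L u v = x)" for \<mu>
  have l: "l (M u v) = L u v" if uv: "u \<in> U" "v \<in> U" for u v
  proof -
    have "\<exists>x. \<exists>u'\<in>U. \<exists>v'\<in>U. M u' v' = M u v \<and> L u' v' = x" using uv by blast
    from someI_ex[OF this] obtain u' v' where uv': "u' \<in> U" "v' \<in> U" "M u' v' = M u v" "L u' v' = l (M u v)"
      unfolding l_def by blast
    obtain \<sigma> where "\<sigma> permutes {..<n}" "u' = u \<circ> \<sigma>" "v' = v \<circ> \<sigma>"
      using image_mset_pair_eq_imp_permutes[of "{..<n}" u "{..<k}" u' v "{..<k}" v'] uv uv'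
      unfolding M_def U_def by blast
    then show ?thesis using inv uv uv'(4) by metis
  qed
  have "(\<Sum>v\<in>U. R v w * l (M u v)) = (\<Sum>v\<in>U. R u v * l (M v w))"
    by (rule monom_fun_linear_extension[OF U U]) (use comm[OF uw] in \<open>simp add: monom mult.commute\<close>)
  moreover have "(\<Sum>v\<in>U. R v w * l (M u v)) = (\<Sum>v\<in>U. L u v * R v w)"
    by (rule sum.cong) (simp_all add: l uw)
  moreover have "(\<Sum>v\<in>U. R u v * l (M v w)) = (\<Sum>v\<in>U. R u v * L v w)"
    by (rule sum.cong) (simp_all add: l uw)
  ultimately show ?thesis by simp
qed

lemma monom_fun_tensor_monomial_row_action:
  "monom_fun (tensor_monomial n I J u w) (row_action k G z) =
    (\<Sum>v\<in>{..<n} \<rightarrow>\<^sub>E {..<k}. tensor_power n G v u * monom_fun (tensor_monomial n I J v w) z)"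
  unfolding monom_fun_tensor_monomial row_action_def
  by (simp add: prod_sum_PiE prod.distrib tensor_power_def sum_distrib_left sum_distrib_right mult_ac)

lemma monom_fun_tensor_monomial_col_action:
  "monom_fun (tensor_monomial n I J u w) (col_action k G z) =
    (\<Sum>v\<in>{..<n} \<rightarrow>\<^sub>E {..<k}. tensor_power n G w v * monom_fun (tensor_monomial n I J u v) z)"
  unfolding monom_fun_tensor_monomial col_action_def
  by (simp add: prod_sum_PiE prod.distrib tensor_power_def sum_distrib_left sum_distrib_right mult_ac)

text \<open>
  Scalar matrices detect the degree in \<open>X\<close> through \<open>row_action\<close> and, in the next lemma, the degree in
  \<open>Y\<close> through \<open>col_action\<close>.
\<close>

lemma monom_fun_scalar_row_action:
  assumes "set_mset \<mu> \<subseteq> coordinates k p q"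
  shows "monom_fun \<mu> (row_action k (\<lambda>(a, b). if a = b then t else 0) z) = t ^ size (filter_mset isl \<mu>) * monom_fun \<mu> z"
  using assms
proof (induction \<mu>)
  case (add v \<mu>)
  have "row_action k (\<lambda>(a, b). if a = b then t else 0) z v = (if isl v then t else 1) * z v"
    using add.prems by (auto simp: row_action_def coordinates_def if_distrib[of "(*) _"] mult.commute cong: if_cong)
  then show ?case using add by (auto simp: monom_fun_def)
qed (simp add: monom_fun_def)

lemma monom_fun_scalar_col_action:
  assumes "set_mset \<mu> \<subseteq> coordinates k p q"
  shows "monom_fun \<mu> (col_action k (\<lambda>(a, b). if a = b then t else 0) z) = t ^ size (filter_mset (\<lambda>v. \<not> isl v) \<mu>) * monom_fun \<mu> z"
  using assms
proof (induction \<mu>)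
  case (add v \<mu>)
  have "col_action k (\<lambda>(a, b). if a = b then t else 0) z v = (if isl v then 1 else t) * z v"
    using add.prems by (auto simp: col_action_def coordinates_def if_distrib[of "(*) _"] mult.commute cong: if_cong)
  then show ?case using add by (auto simp: monom_fun_def)
qed (simp add: monom_fun_def)

lemma balanced_monomial_enumeration:
  assumes \<mu>: "set_mset \<mu> \<subseteq> coordinates k p q"
    and size: "size (filter_mset isl \<mu>) = n" "size (filter_mset (\<lambda>v. \<not> isl v) \<mu>) = n"
  shows "\<exists>I\<in>{..<n} \<rightarrow>\<^sub>E {1..p}. \<exists>J\<in>{..<n} \<rightarrow>\<^sub>E {1..q}. \<exists>u\<in>{..<n} \<rightarrow>\<^sub>E {..<k}. \<exists>w\<in>{..<n} \<rightarrow>\<^sub>E {..<k}.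
    tensor_monomial n I J u w = \<mu>"
proof -
  obtain X where X: "filter_mset isl \<mu> = image_mset X (mset_set {..<n})"
    using mset_enumeration[of "filter_mset isl \<mu>"] size(1) by auto
  obtain Y where Y: "filter_mset (\<lambda>v. \<not> isl v) \<mu> = image_mset Y (mset_set {..<n})"
    using mset_enumeration[of "filter_mset (\<lambda>v. \<not> isl v) \<mu>"] size(2) by auto
  have Xt: "\<exists>i a. X t = Inl (i, a) \<and> i \<in> {1..p} \<and> a < k" if "t < n" for t
  proof -
    have "X t \<in># image_mset X (mset_set {..<n})" using that by simp
    then have "X t \<in># \<mu> \<and> isl (X t)" unfolding X[symmetric] by simp
    then have "X t \<in> coordinates k p q" "isl (X t)" using \<mu> by auto
    then show ?thesis by (auto simp: coordinates_def)
  qed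
  have Yt: "\<exists>a j. Y t = Inr (a, j) \<and> j \<in> {1..q} \<and> a < k" if "t < n" for t
  proof -
    have "Y t \<in># image_mset Y (mset_set {..<n})" using that by simp
    then have "Y t \<in># \<mu> \<and> \<not> isl (Y t)" unfolding Y[symmetric] by simp
    then have "Y t \<in> coordinates k p q" "\<not> isl (Y t)" using \<mu> by auto
    then show ?thesis by (auto simp: coordinates_def)
  qed
  define I where "I = restrict (\<lambda>t. fst (projl (X t))) {..<n}"
  define u where "u = restrict (\<lambda>t. snd (projl (X t))) {..<n}"
  define w where "w = restrict (\<lambda>t. fst (projr (Y t))) {..<n}"
  define J where "J = restrict (\<lambda>t. snd (projr (Y t))) {..<n}"
  have "I \<in> {..<n} \<rightarrow>\<^sub>E {1..p}" "J \<in> {..<n} \<rightarrow>\<^sub>E {1..q}" "u \<in> {..<n} \<rightarrow>\<^sub>E {..<k}" "w \<in> {..<n} \<rightarrow>\<^sub>E {..<k}"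
    using Xt Yt unfolding I_def J_def u_def w_def by (simp_all only: restrict_PiE_iff) force+
  moreover have "tensor_monomial n I J u w = \<mu>"
  proof -
    have "image_mset (\<lambda>t. Inl (I t, u t)) (mset_set {..<n}) = image_mset X (mset_set {..<n})"
      by (rule image_mset_cong) (use Xt in \<open>force simp: I_def u_def\<close>)
    moreover have "image_mset (\<lambda>t. Inr (w t, J t)) (mset_set {..<n}) = image_mset Y (mset_set {..<n})"
      by (rule image_mset_cong) (use Yt in \<open>force simp: J_def w_def\<close>)
    ultimately show ?thesis
      unfolding tensor_monomial_def X[symmetric] Y[symmetric]
      by (simp only: multiset_partition[symmetric])
  qed
  ultimately show ?thesis by blast
qed

lemma sum_swap_outer:
  "(\<Sum>u\<in>A. \<Sum>w\<in>B. \<Sum>v\<in>C. f u w v) = (\<Sum>v\<in>C. \<Sum>w\<in>B. \<Sum>u\<in>A. f u w v)"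
proof -
  have "(\<Sum>u\<in>A. \<Sum>w\<in>B. \<Sum>v\<in>C. f u w v) = (\<Sum>u\<in>A. \<Sum>v\<in>C. \<Sum>w\<in>B. f u w v)"
    by (rule sum.cong[OF refl], rule sum.swap)
  also have "\<dots> = (\<Sum>v\<in>C. \<Sum>u\<in>A. \<Sum>w\<in>B. f u w v)" by (rule sum.swap)
  also have "\<dots> = (\<Sum>v\<in>C. \<Sum>w\<in>B. \<Sum>u\<in>A. f u w v)"
    by (rule sum.cong[OF refl], rule sum.swap)
  finally show ?thesis .
qed

section \<open>Polynomials of two matrices invariant under base change\<close>

text \<open>
  The substitutions of \<open>2 \<cdot> 1\<close> on either side multiply a monomial by \<open>2\<close> to its degree in \<open>X\<close> and in
  \<open>Y\<close>, so the two degrees agree in every monomial that occurs; in particular there is none if \<open>d\<close>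
  is odd. The coefficient of each monomial is then distributed evenly over the index tuples that
  describe it.
\<close>

lemma invariant_polynomial_symmetric_coefficients:
  assumes A: "finite A" "\<And>\<mu>. \<mu> \<in> A \<Longrightarrow> set_mset \<mu> \<subseteq> coordinates k p q \<and> size \<mu> = d"
    and F: "\<And>z. F z = (\<Sum>\<mu>\<in>A. c \<mu> * monom_fun \<mu> z)"
    and inv: "\<And>z G. F (row_action k G z) = F (col_action k G z)"
    and n: "n = d div 2"
  shows "\<exists>e. (\<forall>\<mu>. e \<mu> \<noteq> 0 \<longrightarrow> even d) \<and> (\<forall>z. F z = (\<Sum>I\<in>{..<n} \<rightarrow>\<^sub>E {1..p}. \<Sum>J\<in>{..<n} \<rightarrow>\<^sub>E {1..q}. \<Sum>u\<in>{..<n} \<rightarrow>\<^sub>E {..<k}. \<Sum>w\<in>{..<n} \<rightarrow>\<^sub>E {..<k}.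
     e (tensor_monomial n I J u w) * monom_fun (tensor_monomial n I J u w) z))"
proof -
  let ?sc = "\<lambda>(a, b). if a = b then 2 else 0"
  let ?l = "\<lambda>\<mu>. size (filter_mset isl \<mu>)" and ?r = "\<lambda>\<mu>. size (filter_mset (\<lambda>v. \<not> isl v) \<mu>)"
  have "(\<Sum>\<mu>\<in>A. (c \<mu> * (2 ^ ?l \<mu> - 2 ^ ?r \<mu>)) * monom_fun \<mu> z) = 0" for z
  proof -
    have "F (row_action k ?sc z) = (\<Sum>\<mu>\<in>A. c \<mu> * (2 ^ ?l \<mu> * monom_fun \<mu> z))"
      unfolding F by (rule sum.cong) (simp_all add: A(2) monom_fun_scalar_row_action[of _ k p q])
    moreover have "F (col_action k ?sc z) = (\<Sum>\<mu>\<in>A. c \<mu> * (2 ^ ?r \<mu> * monom_fun \<mu> z))"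
      unfolding F by (rule sum.cong) (simp_all add: A(2) monom_fun_scalar_col_action[of _ k p q])
    ultimately have "(\<Sum>\<mu>\<in>A. c \<mu> * (2 ^ ?l \<mu> * monom_fun \<mu> z)) - (\<Sum>\<mu>\<in>A. c \<mu> * (2 ^ ?r \<mu> * monom_fun \<mu> z)) = 0"
      using inv[of ?sc z] by simp
    then show ?thesis unfolding sum_subtractf[symmetric] by (simp add: algebra_simps)
  qed
  then have zero: "c \<mu> * (2 ^ ?l \<mu> - 2 ^ ?r \<mu>) = 0" if "\<mu> \<in> A" for \<mu>
    using monom_funs_independent[OF A(1), of "\<lambda>\<mu>. c \<mu> * (2 ^ ?l \<mu> - 2 ^ ?r \<mu>)" \<mu>] that by simp
  have pow2: "(2::complex) ^ a = 2 ^ b \<longleftrightarrow> a = b" for a b :: nat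
  proof -
    have "(2::complex) ^ a = 2 ^ b \<longleftrightarrow> of_nat (2 ^ a) = (of_nat (2 ^ b) :: complex)" by simp
    also have "\<dots> \<longleftrightarrow> a = b" unfolding of_nat_eq_iff by simp
    finally show ?thesis .
  qed
  have lr: "?l \<mu> = ?r \<mu>" if "\<mu> \<in> A" "c \<mu> \<noteq> 0" for \<mu>
    using zero[OF that(1)] that(2) by (simp add: pow2)
  have lrn: "?l \<mu> = n" "?r \<mu> = n" "even d" if "\<mu> \<in> A" "c \<mu> \<noteq> 0" for \<mu>
  proof -
    have "size \<mu> = ?l \<mu> + ?r \<mu>" by (metis multiset_partition size_union)
    with lr[OF that] A(2)[OF that(1)] have "d = 2 * ?r \<mu>" by simp
    with lr[OF that] n show "?l \<mu> = n" "?r \<mu> = n" "even d" by simp_all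
  qed
  let ?U = "{..<n} \<rightarrow>\<^sub>E {..<k}" and ?X = "{..<n} \<rightarrow>\<^sub>E {1..p}" and ?Y = "{..<n} \<rightarrow>\<^sub>E {1..q}"
  define H where "H = ?X \<times> ?Y \<times> ?U \<times> ?U"
  have H: "finite H" unfolding H_def by (intro finite_cartesian_product finite_PiE finite_lessThan finite_atLeastAtMost)
  define M where "M = (\<lambda>(I, J, u, w). tensor_monomial n I J u w)"
  define A' where "A' = {\<mu> \<in> A. c \<mu> \<noteq> 0}"
  have A'M: "A' \<subseteq> M ` H"
  proof
    fix \<mu> assume \<mu>: "\<mu> \<in> A'"
    then obtain I J u w where *: "I \<in> ?X" "J \<in> ?Y" "u \<in> ?U" "w \<in> ?U" "tensor_monomial n I J u w = \<mu>"
      using balanced_monomial_enumeration[of \<mu> k p q n] A(2)[of \<mu>] lrn[of \<mu>] unfolding A'_def by blast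
    show "\<mu> \<in> M ` H"
      by (rule image_eqI[of _ _ "(I, J, u, w)"]) (use * in \<open>simp_all add: H_def M_def\<close>)
  qed
  \<comment> \<open>the number of index tuples that describe a monomial\<close>
  define N where "N \<mu> = card {h \<in> H. M h = \<mu>}" for \<mu>
  have N: "N \<mu> \<noteq> 0" if "\<mu> \<in> M ` H" for \<mu>
  proof -
    have "{h \<in> H. M h = \<mu>} \<noteq> {}" using that by blast
    then show ?thesis unfolding N_def using H by simp
  qed
  define e where "e \<mu> = (if \<mu> \<in> A' then c \<mu> / of_nat (N \<mu>) else 0)" for \<mu>
  have "F z = (\<Sum>h\<in>H. e (M h) * monom_fun (M h) z)" for z
  proof -
    have "F z = (\<Sum>\<mu>\<in>A'. c \<mu> * monom_fun \<mu> z)"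
      unfolding F A'_def by (rule sum.mono_neutral_right[OF A(1)]) auto
    also have "\<dots> = (\<Sum>\<mu>\<in>M ` H. (if \<mu> \<in> A' then c \<mu> else 0) * monom_fun \<mu> z)"
      by (rule sum.mono_neutral_cong_left) (use A'M H in auto)
    also have "\<dots> = (\<Sum>\<mu>\<in>M ` H. \<Sum>h | h \<in> H \<and> M h = \<mu>. e (M h) * monom_fun (M h) z)"
    proof (rule sum.cong[OF refl])
      fix \<mu> assume \<mu>: "\<mu> \<in> M ` H"
      have "(\<Sum>h | h \<in> H \<and> M h = \<mu>. e (M h) * monom_fun (M h) z) = (\<Sum>h | h \<in> H \<and> M h = \<mu>. e \<mu> * monom_fun \<mu> z)"
        by (rule sum.cong) auto
      also have "\<dots> = of_nat (N \<mu>) * (e \<mu> * monom_fun \<mu> z)"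
        by (simp only: sum_constant N_def)
      also have "\<dots> = (if \<mu> \<in> A' then c \<mu> else 0) * monom_fun \<mu> z"
        using N[OF \<mu>] by (simp add: e_def)
      finally show "(if \<mu> \<in> A' then c \<mu> else 0) * monom_fun \<mu> z = (\<Sum>h | h \<in> H \<and> M h = \<mu>. e (M h) * monom_fun (M h) z)" ..
    qed
    also have "\<dots> = (\<Sum>h\<in>H. e (M h) * monom_fun (M h) z)"
      by (rule sum.image_gen[symmetric, OF H])
    finally show ?thesis .
  qed
  then have "\<forall>z. F z = (\<Sum>I\<in>?X. \<Sum>J\<in>?Y. \<Sum>u\<in>?U. \<Sum>w\<in>?U.
     e (tensor_monomial n I J u w) * monom_fun (tensor_monomial n I J u w) z)"
    unfolding sum.cartesian_product H_def M_def by (simp add: case_prod_beta)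
  moreover have "even d" if "e \<mu> \<noteq> 0" for \<mu>
    using that lrn(3)[of \<mu>] by (auto simp: e_def A'_def split: if_splits)
  ultimately show ?thesis by blast
qed

text \<open>
  After expansion, both substitutions produce sums over the same index tuples, in which the tensor
  power of \<open>G\<close> multiplies the coefficients from the left and from the right. The difference of the two
  coefficients is unchanged under permutations of positions, so it vanishes term by term.
\<close>

lemma symmetric_coefficients_commute:
  fixes e :: "((nat \<times> nat) + (nat \<times> nat)) multiset \<Rightarrow> complex" and n k p q :: nat
  defines "U \<equiv> {..<n} \<rightarrow>\<^sub>E {..<k}" and "X \<equiv> {..<n} \<rightarrow>\<^sub>E {1..p}" and "Y \<equiv> {..<n} \<rightarrow>\<^sub>E {1..q}"
  assumes F: "\<And>z. F z = (\<Sum>I\<in>X. \<Sum>J\<in>Y. \<Sum>u\<in>U. \<Sum>w\<in>U.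
     e (tensor_monomial n I J u w) * monom_fun (tensor_monomial n I J u w) z)"
    and inv: "\<And>z. F (row_action k G z) = F (col_action k G z)"
    and IJ: "I \<in> X" "J \<in> Y" and uw: "u \<in> U" "w \<in> U"
  shows "(\<Sum>v\<in>U. tensor_power n G u v * e (tensor_monomial n I J v w)) =
    (\<Sum>v\<in>U. e (tensor_monomial n I J u v) * tensor_power n G v w)"
proof -
  let ?m = "tensor_monomial n" and ?g = "tensor_power n G"
  define K where "K I J u w = (\<Sum>v\<in>U. ?g u v * e (?m I J v w)) - (\<Sum>v\<in>U. e (?m I J u v) * ?g v w)" for I J u w
  define H where "H = X \<times> Y \<times> U \<times> U"
  have H: "finite H"
    unfolding H_def X_def Y_def U_def by (intro finite_cartesian_product finite_PiE finite_lessThan finite_atLeastAtMost)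
  have row: "F (row_action k G z) = (\<Sum>I\<in>X. \<Sum>J\<in>Y. \<Sum>u\<in>U. \<Sum>w\<in>U. (\<Sum>v\<in>U. ?g u v * e (?m I J v w)) * monom_fun (?m I J u w) z)" for z
  proof -
    have "F (row_action k G z) = (\<Sum>I\<in>X. \<Sum>J\<in>Y. \<Sum>u\<in>U. \<Sum>w\<in>U. \<Sum>v\<in>U. e (?m I J u w) * (?g v u * monom_fun (?m I J v w) z))"
      unfolding F monom_fun_tensor_monomial_row_action U_def[symmetric] sum_distrib_left ..
    also have "\<dots> = (\<Sum>I\<in>X. \<Sum>J\<in>Y. \<Sum>v\<in>U. \<Sum>w\<in>U. \<Sum>u\<in>U. e (?m I J u w) * (?g v u * monom_fun (?m I J v w) z))"
      by (intro sum.cong[OF refl] sum_swap_outer)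
    also have "\<dots> = (\<Sum>I\<in>X. \<Sum>J\<in>Y. \<Sum>u\<in>U. \<Sum>w\<in>U. (\<Sum>v\<in>U. ?g u v * e (?m I J v w)) * monom_fun (?m I J u w) z)"
      unfolding sum_distrib_right by (intro sum.cong refl) simp
    finally show ?thesis .
  qed
  have col: "F (col_action k G z) = (\<Sum>I\<in>X. \<Sum>J\<in>Y. \<Sum>u\<in>U. \<Sum>w\<in>U. (\<Sum>v\<in>U. e (?m I J u v) * ?g v w) * monom_fun (?m I J u w) z)" for z
  proof -
    have "F (col_action k G z) = (\<Sum>I\<in>X. \<Sum>J\<in>Y. \<Sum>u\<in>U. \<Sum>w\<in>U. \<Sum>v\<in>U. e (?m I J u w) * (?g w v * monom_fun (?m I J u v) z))"
      unfolding F monom_fun_tensor_monomial_col_action U_def[symmetric] sum_distrib_left ..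
    also have "\<dots> = (\<Sum>I\<in>X. \<Sum>J\<in>Y. \<Sum>u\<in>U. \<Sum>v\<in>U. \<Sum>w\<in>U. e (?m I J u w) * (?g w v * monom_fun (?m I J u v) z))"
      by (intro sum.cong[OF refl] sum.swap)
    also have "\<dots> = (\<Sum>I\<in>X. \<Sum>J\<in>Y. \<Sum>u\<in>U. \<Sum>w\<in>U. (\<Sum>v\<in>U. e (?m I J u v) * ?g v w) * monom_fun (?m I J u w) z)"
      unfolding sum_distrib_right by (intro sum.cong refl) simp
    finally show ?thesis .
  qed
  have zero: "(\<Sum>(I, J, u, w)\<in>H. K I J u w * monom_fun (?m I J u w) z) = 0" for z
  proof -
    have "(\<Sum>(I, J, u, w)\<in>H. K I J u w * monom_fun (?m I J u w) z) = F (row_action k G z) - F (col_action k G z)"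
      unfolding row col K_def left_diff_distrib sum_subtractf H_def sum.cartesian_product
      by (simp add: case_prod_beta sum_subtractf)
    then show ?thesis by (simp add: inv)
  qed
  have perm: "K (I \<circ> \<sigma>) (J \<circ> \<tau>) (u \<circ> \<sigma>) (w \<circ> \<tau>) = K I J u w"
    if \<sigma>: "\<sigma> permutes {..<n}" and \<tau>: "\<tau> permutes {..<n}" for I J u w \<sigma> \<tau>
  proof -
    have "(\<Sum>v\<in>U. ?g (u \<circ> \<sigma>) v * e (?m (I \<circ> \<sigma>) (J \<circ> \<tau>) v (w \<circ> \<tau>))) =
        (\<Sum>v\<in>U. ?g (u \<circ> \<sigma>) (v \<circ> \<sigma>) * e (?m (I \<circ> \<sigma>) (J \<circ> \<tau>) (v \<circ> \<sigma>) (w \<circ> \<tau>)))"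
      unfolding U_def by (rule sum.reindex_bij_betw[symmetric, OF bij_betw_PiE_compose_permutes[OF \<sigma>]])
    moreover have "(\<Sum>v\<in>U. e (?m (I \<circ> \<sigma>) (J \<circ> \<tau>) (u \<circ> \<sigma>) v) * ?g v (w \<circ> \<tau>)) =
        (\<Sum>v\<in>U. e (?m (I \<circ> \<sigma>) (J \<circ> \<tau>) (u \<circ> \<sigma>) (v \<circ> \<tau>)) * ?g (v \<circ> \<tau>) (w \<circ> \<tau>))"
      unfolding U_def by (rule sum.reindex_bij_betw[symmetric, OF bij_betw_PiE_compose_permutes[OF \<tau>]])
    ultimately show ?thesis
      unfolding K_def by (simp only: tensor_monomial_compose[OF \<sigma> \<tau>] tensor_power_compose[OF \<sigma>] tensor_power_compose[OF \<tau>])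
  qed
  let ?c = "\<lambda>(I, J, u, w). K I J u w" and ?M = "\<lambda>(I, J, u, w). ?m I J u w"
  have "?c (I, J, u, w) = 0"
  proof (rule monom_fun_symmetric_coefficient_zero[of H ?c ?M "(I, J, u, w)"])
    show "finite H" by (rule H)
    show "(\<Sum>h\<in>H. ?c h * monom_fun (?M h) z) = 0" for z
      using zero[of z] by (simp add: case_prod_beta)
    show "(I, J, u, w) \<in> H" using IJ uw by (simp add: H_def)
    fix h h' assume h: "h \<in> H" "h' \<in> H" "?M h = ?M h'"
    obtain I J u w where hh: "h = (I, J, u, w)" by (cases h)
    obtain I' J' u' w' where hh': "h' = (I', J', u', w')" by (cases h')
    have "\<exists>\<sigma> \<tau>. \<sigma> permutes {..<n} \<and> \<tau> permutes {..<n} \<and> I' = I \<circ> \<sigma> \<and> u' = u \<circ> \<sigma> \<and> w' = w \<circ> \<tau> \<and> J' = J \<circ> \<tau>"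
      by (rule tensor_monomial_eq_imp_permutes[of I n "{1..p}" I' J "{1..q}" J' u "{..<k}" u' w w'])
        (use h in \<open>simp_all add: hh hh' H_def X_def Y_def U_def\<close>)
    then show "?c h = ?c h'" using perm unfolding hh hh' by auto
  qed
  then show ?thesis by (simp add: K_def)
qed

text \<open>
  For fixed outer indices the symmetric coefficients commute with all tensor powers, so the double
  centralizer property writes them through permutations of positions. Summing over the remaining inner
  indices contracts the \<open>t\<close>-th column factor with the row factor at position \<open>inv \<sigma> t\<close>, which is
  one arc.
\<close>

theorem arc_funs_span_invariants:
  assumes A: "finite A" "\<And>\<mu>. \<mu> \<in> A \<Longrightarrow> set_mset \<mu> \<subseteq> coordinates k p q \<and> size \<mu> = d"
    and F: "\<And>z. F z = (\<Sum>\<mu>\<in>A. c \<mu> * monom_fun \<mu> z)"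
    and inv: "\<And>z G. F (row_action k G z) = F (col_action k G z)"
  shows "F \<in> cfun.span (arc_fun k ` {D. bipartite_arc_diagram p q D \<and> 2 * size D = d})"
proof -
  define n where "n = d div 2"
  let ?U = "{..<n} \<rightarrow>\<^sub>E {..<k}" and ?X = "{..<n} \<rightarrow>\<^sub>E {1..p}" and ?Y = "{..<n} \<rightarrow>\<^sub>E {1..q}"
  let ?m = "tensor_monomial n" and ?P = "{\<sigma>. \<sigma> permutes {..<n}}"
  have U: "finite ?U" by (intro finite_PiE finite_lessThan)
  obtain e where even: "\<And>\<mu>. e \<mu> \<noteq> 0 \<Longrightarrow> even d" and e: "\<And>z. F z = (\<Sum>I\<in>?X. \<Sum>J\<in>?Y. \<Sum>u\<in>?U. \<Sum>w\<in>?U. e (?m I J u w) * monom_fun (?m I J u w) z)"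
    using invariant_polynomial_symmetric_coefficients[OF A F inv n_def] by blast
  have ex: "\<exists>a. \<forall>u\<in>?U. \<forall>w\<in>?U. e (?m I J u w) = (\<Sum>\<sigma>\<in>?P. if u = w \<circ> \<sigma> then a \<sigma> else 0)"
    if IJ: "I \<in> ?X" "J \<in> ?Y" for I J
  proof (rule double_centralizer_permutations)
    fix L :: "(nat \<Rightarrow> nat) \<Rightarrow> (nat \<Rightarrow> nat) \<Rightarrow> complex" and u w
    assume L: "\<And>\<sigma> u w. \<lbrakk>\<sigma> permutes {..<n}; u \<in> ?U; w \<in> ?U\<rbrakk> \<Longrightarrow> L (u \<circ> \<sigma>) (w \<circ> \<sigma>) = L u w"
      and uw: "u \<in> ?U" "w \<in> ?U"
    show "(\<Sum>v\<in>?U. L u v * e (?m I J v w)) = (\<Sum>v\<in>?U. e (?m I J u v) * L v w)"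
    proof (rule commutes_with_symmetric_operators[where n = n and k = k and L = L])
      fix G u w assume "u \<in> ?U" "w \<in> ?U"
      then show "(\<Sum>v\<in>?U. tensor_power n G u v * e (?m I J v w)) = (\<Sum>v\<in>?U. e (?m I J u v) * tensor_power n G v w)"
        by (rule symmetric_coefficients_commute[OF e inv IJ])
    qed (use L uw in blast)+
  qed simp_all
  define a where "a I J = (SOME a. \<forall>u\<in>?U. \<forall>w\<in>?U. e (?m I J u w) = (\<Sum>\<sigma>\<in>?P. if u = w \<circ> \<sigma> then a \<sigma> else 0))" for I J
  have a: "e (?m I J u w) = (\<Sum>\<sigma>\<in>?P. if u = w \<circ> \<sigma> then a I J \<sigma> else 0)"
    if "I \<in> ?X" "J \<in> ?Y" "u \<in> ?U" "w \<in> ?U" for I J u w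
    using someI_ex[OF ex[OF that(1,2)]] that(3,4) unfolding a_def by blast
  define D where "D I J \<sigma> = image_mset (\<lambda>t. (I (inv \<sigma> t), J t)) (mset_set {..<n})" for I J :: "nat \<Rightarrow> nat" and \<sigma>
  have D: "arc_fun k (D I J \<sigma>) z = (\<Sum>w\<in>?U. monom_fun (?m I J (w \<circ> \<sigma>) w) z)" if \<sigma>: "\<sigma> \<in> ?P" for I J \<sigma> z
  proof -
    have "colour_monomial (\<lambda>t. (I (inv \<sigma> t), J t)) w (mset_set {..<n}) = ?m I J (w \<circ> \<sigma>) w" for w
      using tensor_monomial_compose[of \<sigma> n id "I \<circ> inv \<sigma>" J w w] \<sigma>
      by (simp add: colour_monomial_def tensor_monomial_def comp_def permutes_inverses)
    then show ?thesis by (simp add: D_def arc_fun_colouring_expansion)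
  qed
  show ?thesis
  proof (cases "even d")
    case False
    then have "e \<mu> = 0" for \<mu> using even by blast
    then have "F = 0" by (simp add: fun_eq_iff e)
    then show ?thesis by (simp only: cfun.span_zero)
  next
    case True
    have "F = (\<Sum>I\<in>?X. \<Sum>J\<in>?Y. \<Sum>\<sigma>\<in>?P. fun_scale (a I J \<sigma>) (arc_fun k (D I J \<sigma>)))"
  proof
    fix z
    have "F z = (\<Sum>I\<in>?X. \<Sum>J\<in>?Y. \<Sum>u\<in>?U. \<Sum>w\<in>?U. \<Sum>\<sigma>\<in>?P. if u = w \<circ> \<sigma> then a I J \<sigma> * monom_fun (?m I J u w) z else 0)"
      unfolding e by (intro sum.cong refl) (simp add: a sum_distrib_right if_distrib[of "\<lambda>x. x * _"] cong: if_cong)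
    also have "\<dots> = (\<Sum>I\<in>?X. \<Sum>J\<in>?Y. \<Sum>\<sigma>\<in>?P. \<Sum>w\<in>?U. \<Sum>u\<in>?U. if u = w \<circ> \<sigma> then a I J \<sigma> * monom_fun (?m I J u w) z else 0)"
      by (intro sum.cong[OF refl] sum_swap_outer)
    also have "\<dots> = (\<Sum>I\<in>?X. \<Sum>J\<in>?Y. \<Sum>\<sigma>\<in>?P. \<Sum>w\<in>?U. a I J \<sigma> * monom_fun (?m I J (w \<circ> \<sigma>) w) z)"
      by (intro sum.cong refl) (simp add: sum.delta[OF U] PiE_compose_permutes)
    also have "\<dots> = (\<Sum>I\<in>?X. \<Sum>J\<in>?Y. \<Sum>\<sigma>\<in>?P. a I J \<sigma> * arc_fun k (D I J \<sigma>) z)"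
      by (intro sum.cong refl) (simp add: D sum_distrib_left)
    finally show "F z = (\<Sum>I\<in>?X. \<Sum>J\<in>?Y. \<Sum>\<sigma>\<in>?P. fun_scale (a I J \<sigma>) (arc_fun k (D I J \<sigma>))) z"
      by (simp add: sum_fun_apply fun_scale_def)
  qed
  also have "\<dots> \<in> cfun.span (arc_fun k ` {D. bipartite_arc_diagram p q D \<and> 2 * size D = d})"
  proof (intro cfun.span_sum cfun.span_scale cfun.span_base imageI CollectI conjI)
    fix I J \<sigma> assume IJ: "I \<in> ?X" "J \<in> ?Y" and "\<sigma> \<in> ?P"
    then have "inv \<sigma> t < n" if "t < n" for t
      using permutes_in_image[OF permutes_inv, of \<sigma> "{..<n}" t] that by simp
    with IJ show "bipartite_arc_diagram p q (D I J \<sigma>)"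
      by (fastforce simp: D_def bipartite_arc_diagram_def PiE_iff)
    show "2 * size (D I J \<sigma>) = d" using True by (simp add: D_def n_def)
  qed
  finally show ?thesis .
  qed
qed

section \<open>Coordinates on the mixed space\<close>

lemma vector_space_complex: "vector_space ((*) :: complex \<Rightarrow> complex \<Rightarrow> complex)"
  by unfold_locales (simp_all add: algebra_simps)

locale coordinatized_space = finite_dimensional_vector_space s B
  for s :: "complex \<Rightarrow> 'v::ab_group_add \<Rightarrow> 'v" and B :: "'v set" +
  fixes k :: nat and e :: "nat \<Rightarrow> 'v"
  assumes enum: "bij_betw e {..<k} B"
begin

definition coord :: "nat \<Rightarrow> 'v \<Rightarrow> complex" where
  "coord a v = representation B v (e a)"

lemma coord_add: "coord a (x + y) = coord a x + coord a y"
  unfolding coord_def by (simp add: representation_add[OF independent_Basis] span_Basis)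

lemma coord_scale: "coord a (s c x) = c * coord a x"
  unfolding coord_def by (simp add: representation_scale[OF independent_Basis] span_Basis)

lemma coord_sum: "coord a (\<Sum>x\<in>A. f x) = (\<Sum>x\<in>A. coord a (f x))"
  unfolding coord_def by (simp add: representation_sum[OF independent_Basis] span_Basis)

lemma coord_basis: "a < k \<Longrightarrow> b < k \<Longrightarrow> coord a (e b) = (if a = b then 1 else 0)"
  using enum representation_basis[OF independent_Basis, of "e b"]
  by (auto simp: coord_def bij_betw_def inj_on_def)

lemma coord_combination:
  assumes "a < k"
  shows "coord a (\<Sum>b<k. s (x b) (e b)) = x a"
proof -
  have "coord a (\<Sum>b<k. s (x b) (e b)) = (\<Sum>b<k. if a = b then x b else 0)"
    unfolding coord_sum coord_scale by (rule sum.cong) (simp_all add: coord_basis assms)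
  then show ?thesis using assms by simp
qed

lemma combination_coord: "(\<Sum>a<k. s (coord a v) (e a)) = v"
proof -
  have "(\<Sum>a<k. s (coord a v) (e a)) = (\<Sum>b\<in>B. s (representation B v b) b)"
    unfolding coord_def using sum.reindex_bij_betw[OF enum, of "\<lambda>b. s (representation B v b) b"] .
  also have "\<dots> = v"
    by (rule sum_representation_eq[OF independent_Basis _ finite_Basis order_refl]) (simp add: span_Basis)
  finally show ?thesis .
qed

lemma linear_functional_iff:
  "Vector_Spaces.linear s (*) \<phi> \<longleftrightarrow> (\<forall>x y. \<phi> (x + y) = \<phi> x + \<phi> y) \<and> (\<forall>c x. \<phi> (s c x) = c * \<phi> x)"
  using vector_space_complex vector_space_axioms by (simp add: Vector_Spaces.linear_iff)

lemma linear_endo_iff: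
  "Vector_Spaces.linear s s g \<longleftrightarrow> (\<forall>x y. g (x + y) = g x + g y) \<and> (\<forall>c x. g (s c x) = s c (g x))"
  using vector_space_axioms by (simp add: Vector_Spaces.linear_iff)

lemma linear_functional_expansion:
  assumes "Vector_Spaces.linear s (*) \<phi>"
  shows "\<phi> v = (\<Sum>a<k. \<phi> (e a) * coord a v)"
proof -
  have add: "\<phi> (x + y) = \<phi> x + \<phi> y" and scale: "\<phi> (s c x) = c * \<phi> x" for x y c
    using assms unfolding linear_functional_iff by auto
  have "\<phi> 0 = 0" using scale[of 0 0] by simp
  then have sum: "\<phi> (\<Sum>a\<in>A. f a) = (\<Sum>a\<in>A. \<phi> (f a))" for A :: "nat set" and f
    by (induction A rule: infinite_finite_induct) (simp_all add: add)
  have "\<phi> v = \<phi> (\<Sum>a<k. s (coord a v) (e a))" by (simp only: combination_coord)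
  then show ?thesis by (simp add: sum scale mult.commute)
qed

definition point :: "nat \<Rightarrow> nat \<Rightarrow> ((nat \<times> nat) + (nat \<times> nat) \<Rightarrow> complex) \<Rightarrow> 'v mixed" where
  "point p q z =
     ((\<lambda>i. if i \<in> {1..p} then (\<lambda>v. \<Sum>a<k. z (Inl (i, a)) * coord a v) else 0),
      (\<lambda>j. if j \<in> {1..q} then (\<Sum>a<k. s (z (Inr (a, j))) (e a)) else 0))"

definition point_coords :: "'v mixed \<Rightarrow> (nat \<times> nat) + (nat \<times> nat) \<Rightarrow> complex" where
  "point_coords w = case_sum (\<lambda>(i, a). fst w i (e a)) (\<lambda>(a, j). coord a (snd w j))"

lemma point_in_mixed_space: "point p q z \<in> mixed_space s p q"
  by (auto simp: mixed_space_def point_def linear_functional_iff coord_add coord_scale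
      sum.distrib ring_distribs sum_distrib_left mult_ac)

lemma point_point_coords:
  assumes "w \<in> mixed_space s p q"
  shows "point p q (point_coords w) = w"
proof -
  obtain \<phi> v where w: "w = (\<phi>, v)" by force
  have "(if i \<in> {1..p} then (\<lambda>v. \<Sum>a<k. \<phi> i (e a) * coord a v) else 0) = \<phi> i" for i
  proof (cases "i \<in> {1..p}")
    case True
    then have "Vector_Spaces.linear s (*) (\<phi> i)" using assms by (auto simp: mixed_space_def w)
    then have "(\<lambda>v. \<Sum>a<k. \<phi> i (e a) * coord a v) = \<phi> i"
      by (intro ext linear_functional_expansion[symmetric])
    then show ?thesis using True by (simp only: if_True)
  qed (use assms in \<open>auto simp: mixed_space_def w\<close>)
  moreover have "(if j \<in> {1..q} then (\<Sum>a<k. s (coord a (v j)) (e a)) else 0) = v j" for j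
    using assms by (auto simp: mixed_space_def w combination_coord)
  ultimately show ?thesis by (simp only: point_def point_coords_def w sum.case prod.case fst_conv snd_conv)
qed

lemma contraction_point:
  assumes "i \<in> {1..p}" "j \<in> {1..q}"
  shows "contraction i j (point p q z) = (\<Sum>a<k. z (Inl (i, a)) * z (Inr (a, j)))"
  using assms by (simp add: contraction_def point_def coord_combination)

lemma diagram_fun_point:
  assumes "bipartite_arc_diagram p q D"
  shows "diagram_fun s p q D (point p q z) = arc_fun k D z"
proof -
  have "(\<Prod>(i, j)\<in>#D. contraction i j (point p q z)) = arc_fun k D z"
    unfolding arc_fun_def
    by (rule arg_cong[where f = prod_mset], rule image_mset_cong)
      (use assms contraction_point in \<open>auto simp: bipartite_arc_diagram_def\<close>)
  then show ?thesis by (simp add: diagram_fun_def on_space_def point_in_mixed_space)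
qed

lemma point_add: "point p q (\<lambda>v. x v + y v) = point p q x + point p q y"
  by (auto simp: point_def fun_eq_iff scale_left_distrib sum.distrib ring_distribs)

lemma point_scale: "point p q (\<lambda>v. c * x v) = mixed_scale s c (point p q x)"
  by (auto simp: point_def mixed_scale_def fun_eq_iff sum_distrib_left mult_ac scale_sum_right)

lemma point_cong:
  assumes "\<And>v. v \<in> coordinates k p q \<Longrightarrow> x v = y v"
  shows "point p q x = point p q y"
proof -
  have "x (Inl (i, a)) = y (Inl (i, a))" if "i \<in> {1..p}" "a < k" for i a
    by (rule assms) (use that in \<open>auto simp: coordinates_def\<close>)
  then have "(if i \<in> {1..p} then (\<lambda>v. \<Sum>a<k. x (Inl (i, a)) * coord a v) else 0) =
      (if i \<in> {1..p} then (\<lambda>v. \<Sum>a<k. y (Inl (i, a)) * coord a v) else 0)" for i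
    by simp
  moreover have "x (Inr (a, j)) = y (Inr (a, j))" if "j \<in> {1..q}" "a < k" for a j
    by (rule assms) (use that in \<open>auto simp: coordinates_def\<close>)
  then have "(if j \<in> {1..q} then (\<Sum>a<k. s (x (Inr (a, j))) (e a)) else 0) =
      (if j \<in> {1..q} then (\<Sum>a<k. s (y (Inr (a, j))) (e a)) else 0)" for j
    by simp
  ultimately show ?thesis by (simp only: point_def)
qed

text \<open>
  A functional is linear on the mixed space only, so its value is expanded along points, which
  stay inside this space.
\<close>

lemma functional_on_point:
  assumes L: "functional_on (mixed_scale s) (mixed_space s p q) L"
  shows "L (point p q z) = (\<Sum>v\<in>coordinates k p q. z v * L (point p q (\<lambda>u. if u = v then 1 else 0)))"
proof -
  have fin: "finite (coordinates k p q)" by (simp add: coordinates_def)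
  have add: "L (point p q (\<lambda>v. x v + y v)) = L (point p q x) + L (point p q y)" for x y
    using L by (simp add: functional_on_def point_add point_in_mixed_space)
  have scale: "L (point p q (\<lambda>v. c * x v)) = c * L (point p q x)" for c x
    using L by (simp add: functional_on_def point_scale point_in_mixed_space)
  have "L (point p q (\<lambda>v. if v \<in> S then z v else 0)) = (\<Sum>v\<in>S. z v * L (point p q (\<lambda>u. if u = v then 1 else 0)))"
    if "finite S" for S
    using that
  proof (induction S rule: finite_induct)
    case empty
    then show ?case using scale[of 0 "\<lambda>_. 0"] by simp
  next
    case (insert x S)
    have "(\<lambda>v. if v \<in> insert x S then z v else 0) =
        (\<lambda>v. z x * (if v = x then 1 else 0) + (if v \<in> S then z v else 0))"
      using insert.hyps by (auto simp: fun_eq_iff)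
    then show ?case using insert by (simp add: add scale)
  qed
  from this[OF fin] show ?thesis
    using point_cong[of p q "\<lambda>v. if v \<in> coordinates k p q then z v else 0" z] by simp
qed

text \<open>
  Each of the \<open>d\<close> linear functionals is a linear form in the coordinates, and their product expands
  into monomials of degree \<open>d\<close>.
\<close>

lemma hom_poly_fun_point:
  assumes "f \<in> hom_poly_funs (mixed_scale s) (mixed_space s p q) d"
  shows "(\<lambda>z. f (point p q z)) \<in> cfun.span (monom_fun ` {\<mu>. set_mset \<mu> \<subseteq> coordinates k p q \<and> size \<mu> = d})"
  using assms unfolding hom_poly_funs_def
proof (induction rule: cfun.span_induct_alt)
  case base
  have "(\<lambda>z. 0 (point p q z)) = (0 :: ((nat \<times> nat) + (nat \<times> nat) \<Rightarrow> complex) \<Rightarrow> complex)" by (simp add: fun_eq_iff)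
  then show ?case by (simp only: cfun.span_zero)
next
  case (step c x y)
  let ?C = "coordinates k p q"
  have fin: "finite ?C" by (simp add: coordinates_def)
  from step obtain L where x: "x = on_space (mixed_space s p q) (\<lambda>w. \<Prod>m<d. L m w)"
    and L: "\<And>m. m < d \<Longrightarrow> functional_on (mixed_scale s) (mixed_space s p q) (L m)" by blast
  define l where "l m v = L m (point p q (\<lambda>u. if u = v then 1 else 0))" for m v
  have "(\<lambda>z. x (point p q z)) = (\<Sum>h\<in>{..<d} \<rightarrow>\<^sub>E ?C.
      fun_scale (\<Prod>m<d. l m (h m)) (monom_fun (image_mset h (mset_set {..<d}))))"
  proof
    fix z
    have "x (point p q z) = (\<Prod>m<d. \<Sum>v\<in>?C. z v * l m v)"
      unfolding x on_space_def using point_in_mixed_space functional_on_point[OF L]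
      by (simp add: l_def)
    also have "\<dots> = (\<Sum>h\<in>{..<d} \<rightarrow>\<^sub>E ?C. \<Prod>m<d. z (h m) * l m (h m))"
      by (rule prod_sum_PiE) (simp_all add: fin)
    finally show "x (point p q z) = (\<Sum>h\<in>{..<d} \<rightarrow>\<^sub>E ?C.
      fun_scale (\<Prod>m<d. l m (h m)) (monom_fun (image_mset h (mset_set {..<d})))) z"
      by (simp add: sum_fun_apply fun_scale_def monom_fun_image_mset_set prod.distrib mult.commute)
  qed
  also have "\<dots> \<in> cfun.span (monom_fun ` {\<mu>. set_mset \<mu> \<subseteq> ?C \<and> size \<mu> = d})"
    by (intro cfun.span_sum cfun.span_scale cfun.span_base imageI) auto
  finally have "fun_scale c (\<lambda>z. x (point p q z)) + (\<lambda>z. y (point p q z)) \<in>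
      cfun.span (monom_fun ` {\<mu>. set_mset \<mu> \<subseteq> ?C \<and> size \<mu> = d})"
    using step by (intro cfun.span_add cfun.span_scale)
  moreover have "(\<lambda>z. (fun_scale c x + y) (point p q z)) = fun_scale c (\<lambda>z. x (point p q z)) + (\<lambda>z. y (point p q z))"
    by (simp add: fun_eq_iff fun_scale_def)
  ultimately show ?case by simp
qed

lemma functional_on_point_coords: "functional_on (mixed_scale s) W (\<lambda>w. point_coords w v)"
  by (cases v) (auto simp: functional_on_def point_coords_def mixed_scale_def coord_add coord_scale)

lemma hom_poly_fun_monomial:
  assumes "size \<mu> = d"
  shows "on_space W (\<lambda>w. monom_fun \<mu> (point_coords w)) \<in> hom_poly_funs (mixed_scale s) W d"
proof -
  obtain X where X: "\<mu> = image_mset X (mset_set {..<d})" using mset_enumeration[of \<mu>] assms by auto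
  have "on_space W (\<lambda>w. monom_fun \<mu> (point_coords w)) = on_space W (\<lambda>w. \<Prod>m<d. point_coords w (X m))"
    by (simp only: X monom_fun_image_mset_set)
  then show ?thesis
    unfolding hom_poly_funs_def
    by (intro cfun.span_base CollectI exI[of _ "\<lambda>m w. point_coords w (X m)"])
      (simp add: functional_on_point_coords)
qed

lemma diagram_fun_hom_poly:
  assumes D: "bipartite_arc_diagram p q D" "total_degree p q D = d"
  shows "diagram_fun s p q D \<in> hom_poly_funs (mixed_scale s) (mixed_space s p q) d"
proof -
  let ?W = "mixed_space s p q" and ?T = "mset_set {..<size D}"
  obtain A where A: "D = image_mset A ?T" using mset_enumeration by blast
  have "diagram_fun s p q D =
      (\<Sum>u\<in>{..<size D} \<rightarrow>\<^sub>E {..<k}. on_space ?W (\<lambda>w. monom_fun (colour_monomial A u ?T) (point_coords w)))"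
  proof
    fix w
    show "diagram_fun s p q D w =
      (\<Sum>u\<in>{..<size D} \<rightarrow>\<^sub>E {..<k}. on_space ?W (\<lambda>w. monom_fun (colour_monomial A u ?T) (point_coords w))) w"
    proof (cases "w \<in> ?W")
      case True
      have "diagram_fun s p q D w = arc_fun k D (point_coords w)"
        using diagram_fun_point[OF D(1), of "point_coords w"] point_point_coords[OF True] by simp
      also have "\<dots> = arc_fun k (image_mset A ?T) (point_coords w)" by (simp only: A[symmetric])
      also have "\<dots> = (\<Sum>u\<in>{..<size D} \<rightarrow>\<^sub>E {..<k}. monom_fun (colour_monomial A u ?T) (point_coords w))"
        by (rule arc_fun_colouring_expansion) simp
      finally show ?thesis using True by (simp add: sum_fun_apply on_space_def)
    qed (simp add: diagram_fun_def on_space_def sum_fun_apply)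
  qed
  also have "\<dots> \<in> hom_poly_funs (mixed_scale s) ?W d"
    unfolding hom_poly_funs_def
  proof (rule cfun.span_sum, fold hom_poly_funs_def, rule hom_poly_fun_monomial)
    show "size (colour_monomial A u ?T) = d" for u
      using total_degree_eq[OF D(1)] D(2) by (simp only: colour_monomial_def size_union size_image_mset size_mset_set card_lessThan)
  qed
  finally show ?thesis .
qed

lemma GL_act_mixed_space:
  assumes g: "g \<in> GL s" and w: "w \<in> mixed_space s p q"
  shows "GL_act g w \<in> mixed_space s p q"
proof -
  have lin: "Vector_Spaces.linear s s g" and bij: "bij g" using g by (simp_all add: GL_def)
  have add: "g (x + y) = g x + g y" and scale: "g (s c x) = s c (g x)" for x y c
    using lin unfolding linear_endo_iff by blast+
  have inv: "inv g (g x) = x" "g (inv g x) = x" for x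
    using bij by (simp_all add: bij_is_inj bij_is_surj surj_f_inv_f)
  have inv_add: "inv g (x + y) = inv g x + inv g y" for x y
    using inv(1)[of "inv g x + inv g y"] unfolding add inv(2) .
  have inv_scale: "inv g (s c x) = s c (inv g x)" for c x
    using inv(1)[of "s c (inv g x)"] unfolding scale inv(2) .
  have g0: "g 0 = 0" using scale[of 0 0] by simp
  obtain \<phi> v where w': "w = (\<phi>, v)" by force
  have W: "\<forall>i\<in>{1..p}. Vector_Spaces.linear s (*) (\<phi> i)" "\<forall>i. i \<notin> {1..p} \<longrightarrow> \<phi> i = 0"
      "\<forall>j. j \<notin> {1..q} \<longrightarrow> v j = 0"
    using w by (auto simp only: mixed_space_def w' mem_Collect_eq prod.case)
  have "Vector_Spaces.linear s (*) (\<phi> i \<circ> inv g)" if "i \<in> {1..p}" for i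
    using W(1) that unfolding linear_functional_iff comp_apply inv_add inv_scale by blast
  moreover have "\<phi> i \<circ> inv g = 0" if "i \<notin> {1..p}" for i
    using W(2) that by (simp only: fun_eq_iff comp_apply zero_fun_apply) blast
  moreover have "g (v j) = 0" if "j \<notin> {1..q}" for j
    using W(3) that g0 by metis
  ultimately show ?thesis unfolding mixed_space_def GL_act_def w' fst_conv snd_conv by blast
qed

lemma diagram_fun_invariant:
  assumes g: "g \<in> GL s" and w: "w \<in> mixed_space s p q"
  shows "diagram_fun s p q D (GL_act g w) = diagram_fun s p q D w"
proof -
  have "bij g" using g by (simp add: GL_def)
  then have "inv g (g x) = x" for x by (simp add: bij_is_inj)
  then have "contraction i j (GL_act g w) = contraction i j w" for i j
    by (simp only: contraction_def GL_act_def fst_conv snd_conv comp_apply)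
  then show ?thesis by (simp add: diagram_fun_def on_space_def w GL_act_mixed_space[OF g w])
qed

end

section \<open>Invariants in coordinates\<close>

definition add_scalar :: "(nat \<times> nat \<Rightarrow> complex) \<Rightarrow> complex \<Rightarrow> nat \<times> nat \<Rightarrow> complex" where
  "add_scalar G t = (\<lambda>(a, b). G (a, b) + (if a = b then t else 0))"

lemma monom_fun_line_polynomial:
  assumes "\<And>v t. v \<in># \<mu> \<Longrightarrow> x t v = y v + t * y' v"
  shows "monom_fun \<mu> (x t) = poly (\<Prod>v\<in>#\<mu>. [:y v, y' v:]) t"
proof -
  have "monom_fun \<mu> (x t) = (\<Prod>v\<in>#\<mu>. y v + t * y' v)"
    unfolding monom_fun_def by (rule arg_cong[where f = prod_mset], rule image_mset_cong) (rule assms)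
  also have "\<dots> = poly (\<Prod>v\<in>#\<mu>. [:y v, y' v:]) t" by (induction \<mu>) (simp_all add: ring_distribs mult_ac)
  finally show ?thesis .
qed

lemma row_action_add_scalar:
  assumes "v \<in> coordinates k p q"
  shows "row_action k (add_scalar G t) z v = row_action k G z v + t * (if isl v then z v else 0)"
proof (cases v)
  case (Inl x)
  then obtain i a where v: "v = Inl (i, a)" by (cases x) auto
  then have a: "a < k" using assms by (auto simp: coordinates_def)
  have "(\<Sum>b<k. z (Inl (i, b)) * add_scalar G t (b, a)) =
      (\<Sum>b<k. z (Inl (i, b)) * G (b, a)) + (\<Sum>b<k. if b = a then z (Inl (i, b)) * t else 0)"
    unfolding sum.distrib[symmetric] by (rule sum.cong) (simp_all add: add_scalar_def ring_distribs)
  with a show ?thesis by (simp add: row_action_def v mult.commute)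
qed (simp add: row_action_def)

lemma col_action_add_scalar:
  assumes "v \<in> coordinates k p q"
  shows "col_action k (add_scalar G t) z v = col_action k G z v + t * (if isl v then 0 else z v)"
proof (cases v)
  case (Inr x)
  then obtain a j where v: "v = Inr (a, j)" by (cases x) auto
  then have a: "a < k" using assms by (auto simp: coordinates_def)
  have "(\<Sum>b<k. add_scalar G t (a, b) * z (Inr (b, j))) =
      (\<Sum>b<k. G (a, b) * z (Inr (b, j))) + (\<Sum>b<k. if a = b then t * z (Inr (b, j)) else 0)"
    unfolding sum.distrib[symmetric] by (rule sum.cong) (simp_all add: add_scalar_def ring_distribs)
  with a show ?thesis by (simp add: col_action_def v)
qed (simp add: col_action_def)

text \<open>
  Along the line \<open>G + t \<cdot> 1\<close> both sides are polynomials in \<open>t\<close>. If they agree for all large \<open>t\<close>, they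
  agree at \<open>t = 0\<close>.
\<close>

lemma action_invariance_by_shifting:
  assumes A: "\<And>\<mu>. \<mu> \<in> A \<Longrightarrow> set_mset \<mu> \<subseteq> coordinates k p q"
    and F: "\<And>z. F z = (\<Sum>\<mu>\<in>A. c \<mu> * monom_fun \<mu> z)"
    and large: "\<And>t. N < cmod t \<Longrightarrow> F (row_action k (add_scalar G t) z) = F (col_action k (add_scalar G t) z)"
  shows "F (row_action k G z) = F (col_action k G z)"
proof -
  define P where "P = (\<Sum>\<mu>\<in>A. smult (c \<mu>) (\<Prod>v\<in>#\<mu>. [:row_action k G z v, if isl v then z v else 0:]))"
  define Q where "Q = (\<Sum>\<mu>\<in>A. smult (c \<mu>) (\<Prod>v\<in>#\<mu>. [:col_action k G z v, if isl v then 0 else z v:]))"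
  have P: "F (row_action k (add_scalar G t) z) = poly P t" for t
    unfolding F P_def poly_sum poly_smult
    by (rule sum.cong[OF refl], subst monom_fun_line_polynomial[where x = "\<lambda>t. row_action k (add_scalar G t) z"])
      (use A row_action_add_scalar in blast, rule refl)
  have Q: "F (col_action k (add_scalar G t) z) = poly Q t" for t
    unfolding F Q_def poly_sum poly_smult
    by (rule sum.cong[OF refl], subst monom_fun_line_polynomial[where x = "\<lambda>t. col_action k (add_scalar G t) z"])
      (use A col_action_add_scalar in blast, rule refl)
  have "P - Q = 0"
  proof (rule ccontr)
    assume "P - Q \<noteq> 0"
    then have fin: "finite {t. poly (P - Q) t = 0}" by (rule poly_roots_finite)
    obtain m0 :: nat where m0: "N < real m0" using reals_Archimedean2 by blast
    have "(of_nat :: nat \<Rightarrow> complex) ` {m0..} \<subseteq> {t. poly (P - Q) t = 0}"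
    proof
      fix t :: complex assume "t \<in> of_nat ` {m0..}"
      then have "N < cmod t" using m0 by auto
      from large[OF this] show "t \<in> {t. poly (P - Q) t = 0}" by (simp add: P Q)
    qed
    then have "finite ((of_nat :: nat \<Rightarrow> complex) ` {m0..})" using fin finite_subset by blast
    then have "finite {m0..}" by (rule finite_imageD) (simp add: inj_on_def)
    then show False by (simp add: infinite_Ici)
  qed
  then have "F (row_action k (add_scalar G 0) z) = F (col_action k (add_scalar G 0) z)"
    by (simp add: P Q)
  moreover have "add_scalar G 0 = G" by (simp add: add_scalar_def fun_eq_iff)
  ultimately show ?thesis by simp
qed

context coordinatized_space
begin

definition matrix_map :: "(nat \<times> nat \<Rightarrow> complex) \<Rightarrow> 'v \<Rightarrow> 'v" where
  "matrix_map G v = (\<Sum>a<k. s (\<Sum>b<k. G (a, b) * coord b v) (e a))"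

lemma coord_matrix_map: "a < k \<Longrightarrow> coord a (matrix_map G v) = (\<Sum>b<k. G (a, b) * coord b v)"
  by (simp add: matrix_map_def coord_combination)

lemma linear_matrix_map: "Vector_Spaces.linear s s (matrix_map G)"
  unfolding linear_endo_iff matrix_map_def
proof (intro conjI allI)
  fix x y
  show "(\<Sum>a<k. s (\<Sum>b<k. G (a, b) * coord b (x + y)) (e a)) =
      (\<Sum>a<k. s (\<Sum>b<k. G (a, b) * coord b x) (e a)) + (\<Sum>a<k. s (\<Sum>b<k. G (a, b) * coord b y) (e a))"
    by (simp only: coord_add distrib_left sum.distrib scale_left_distrib)
next
  fix c x
  show "(\<Sum>a<k. s (\<Sum>b<k. G (a, b) * coord b (s c x)) (e a)) = s c (\<Sum>a<k. s (\<Sum>b<k. G (a, b) * coord b x) (e a))"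
    by (simp add: coord_scale scale_sum_right sum_distrib_left mult.left_commute)
qed

lemma eq_zeroI_coord:
  assumes "\<And>a. a < k \<Longrightarrow> coord a v = 0"
  shows "v = 0"
proof -
  have "v = (\<Sum>a<k. s (coord a v) (e a))" by (simp only: combination_coord)
  also have "\<dots> = 0" by (rule sum.neutral) (simp add: assms)
  finally show ?thesis .
qed

text \<open>
  In a vector \<open>v\<close> of the kernel, consider the equation for a coordinate of \<open>v\<close> of largest modulus:
  the diagonal term \<open>t\<close> outweighs all the others unless this coordinate vanishes.
\<close>

lemma diagonally_dominant_GL:
  assumes t: "(\<Sum>a<k. \<Sum>b<k. cmod (G (a, b))) < cmod t"
  shows "matrix_map (add_scalar G t) \<in> GL s"
proof -
  let ?g = "matrix_map (add_scalar G t)"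
  interpret g: Vector_Spaces.linear s s ?g by (rule linear_matrix_map)
  have "v = 0" if v: "?g v = 0" for v
  proof (cases "k = 0")
    case True
    then show ?thesis by (intro eq_zeroI_coord) simp
  next
    case False
    \<comment> \<open>this maximum exists only if there are coordinates at all, hence the separate case \<open>k = 0\<close>\<close>
    let ?M = "Max ((\<lambda>a. cmod (coord a v)) ` {..<k})"
    have "?M \<in> (\<lambda>a. cmod (coord a v)) ` {..<k}" using False by (intro Max_in) auto
    then obtain a where a: "a < k" "cmod (coord a v) = ?M" by auto
    have le: "cmod (coord b v) \<le> cmod (coord a v)" if "b < k" for b
      unfolding a(2) using that by (intro Max_ge) auto
    have "coord a 0 = 0" using coord_scale[of a 0 0] by simp
    then have "0 = (\<Sum>b<k. add_scalar G t (a, b) * coord b v)"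
      using coord_matrix_map[OF a(1), of "add_scalar G t" v] v by simp
    also have "\<dots> = (\<Sum>b<k. G (a, b) * coord b v) + (\<Sum>b<k. if a = b then t * coord b v else 0)"
      unfolding sum.distrib[symmetric] by (rule sum.cong) (simp_all add: add_scalar_def ring_distribs)
    also have "\<dots> = (\<Sum>b<k. G (a, b) * coord b v) + t * coord a v" using a(1) by simp
    finally have "t * coord a v = - (\<Sum>b<k. G (a, b) * coord b v)" by (simp add: eq_neg_iff_add_eq_0 add.commute)
    then have "cmod t * cmod (coord a v) = cmod (\<Sum>b<k. G (a, b) * coord b v)"
      by (metis norm_minus_cancel norm_mult)
    also have "\<dots> \<le> (\<Sum>b<k. cmod (G (a, b)) * cmod (coord a v))"
      by (rule order_trans[OF norm_sum sum_mono]) (simp add: norm_mult mult_left_mono le)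
    also have "\<dots> = (\<Sum>b<k. cmod (G (a, b))) * cmod (coord a v)" by (simp only: sum_distrib_right)
    also have "\<dots> \<le> (\<Sum>a<k. \<Sum>b<k. cmod (G (a, b))) * cmod (coord a v)"
      by (rule mult_right_mono, rule member_le_sum) (use a(1) in \<open>simp_all add: sum_nonneg\<close>)
    finally have "cmod t * cmod (coord a v) \<le> (\<Sum>a<k. \<Sum>b<k. cmod (G (a, b))) * cmod (coord a v)" .
    then have "\<not> 0 < cmod (coord a v)" using t by (meson mult_le_cancel_right_pos not_le)
    then have "cmod (coord a v) = 0" by simp
    then have "coord b v = 0" if "b < k" for b using le[OF that] by simp
    then show ?thesis by (rule eq_zeroI_coord)
  qed
  then have "inj ?g" unfolding g.inj_iff_eq_0 by blast
  moreover from this have "surj ?g" by (rule linear_inj_imp_surj[OF linear_matrix_map])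
  ultimately show ?thesis unfolding GL_def using linear_matrix_map by (simp add: bij_def)
qed

text \<open>
  The functionals transform with the inverse of \<open>g\<close>, so applying \<open>g\<close> to the point of \<open>(X G, Y)\<close> cancels
  the factor \<open>G\<close> at \<open>X\<close> and moves it to \<open>Y\<close>.
\<close>

lemma GL_act_matrix_map_point:
  assumes G: "matrix_map G \<in> GL s"
  shows "GL_act (matrix_map G) (point p q (row_action k G z)) = point p q (col_action k G z)"
proof -
  let ?g = "matrix_map G"
  have bij: "bij ?g" using G by (simp add: GL_def)
  have "(if i \<in> {1..p} then (\<lambda>v. \<Sum>a<k. row_action k G z (Inl (i, a)) * coord a v) else 0) \<circ> inv ?g =
      (if i \<in> {1..p} then (\<lambda>v. \<Sum>a<k. col_action k G z (Inl (i, a)) * coord a v) else 0)" for i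
  proof
    fix v
    obtain u where u: "v = ?g u" using bij by (metis bij_is_surj surjD)
    then have inv: "inv ?g v = u" using bij by (simp add: bij_is_inj)
    have "(\<Sum>a<k. row_action k G z (Inl (i, a)) * coord a u) =
        (\<Sum>a<k. \<Sum>b<k. z (Inl (i, b)) * G (b, a) * coord a u)"
      by (simp add: row_action_def sum_distrib_right)
    also have "\<dots> = (\<Sum>b<k. \<Sum>a<k. z (Inl (i, b)) * G (b, a) * coord a u)" by (rule sum.swap)
    also have "\<dots> = (\<Sum>b<k. z (Inl (i, b)) * coord b v)"
      by (rule sum.cong) (simp_all add: u coord_matrix_map sum_distrib_left mult.assoc)
    finally show "((if i \<in> {1..p} then (\<lambda>v. \<Sum>a<k. row_action k G z (Inl (i, a)) * coord a v) else 0) \<circ> inv ?g) v =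
      (if i \<in> {1..p} then (\<lambda>v. \<Sum>a<k. col_action k G z (Inl (i, a)) * coord a v) else 0) v"
      by (simp add: inv col_action_def)
  qed
  moreover have "?g (if j \<in> {1..q} then (\<Sum>a<k. s (row_action k G z (Inr (a, j))) (e a)) else 0) =
      (if j \<in> {1..q} then (\<Sum>a<k. s (col_action k G z (Inr (a, j))) (e a)) else 0)" for j
  proof (cases "j \<in> {1..q}")
    case True
    have "(\<Sum>b<k. G (a, b) * coord b (\<Sum>a<k. s (row_action k G z (Inr (a, j))) (e a))) = col_action k G z (Inr (a, j))" for a
      by (simp add: coord_combination row_action_def col_action_def)
    then show ?thesis using True by (simp add: matrix_map_def)
  next
    case False
    have "?g 0 = 0" using linear_matrix_map[of G] unfolding linear_endo_iff by (metis scale_zero_left)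
    then show ?thesis using False by (simp only: if_False)
  qed
  ultimately show ?thesis by (simp only: GL_act_def point_def fst_conv snd_conv)
qed

text \<open>
  In coordinates an invariant is a polynomial that does not distinguish the two substitutions: this
  holds for shifts of any \<open>G\<close> by large scalars, which are invertible, and hence for \<open>G\<close> itself.
  Its expansion into diagrams is then straightened.
\<close>

lemma GL_invariant_in_diagram_span:
  assumes f: "f \<in> GL_invariants s p q d"
  shows "f \<in> cfun.span (diagram_fun s p q ` nesting_bounded_diagrams k p q d)"
proof -
  let ?W = "mixed_space s p q" and ?N = "nesting_bounded_diagrams k p q d"
  let ?Ms = "{\<mu>. set_mset \<mu> \<subseteq> coordinates k p q \<and> size \<mu> = d}"
  have hom: "f \<in> hom_poly_funs (mixed_scale s) ?W d"
    and inv: "\<And>g w. g \<in> GL s \<Longrightarrow> w \<in> ?W \<Longrightarrow> f (GL_act g w) = f w"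
    using f by (simp_all add: GL_invariants_def)
  define F where "F z = f (point p q z)" for z
  have "F \<in> cfun.span (monom_fun ` ?Ms)"
    using hom_poly_fun_point[OF hom] by (simp add: F_def[abs_def])
  then obtain S r where S: "finite S" "S \<subseteq> monom_fun ` ?Ms" and FS: "F = (\<Sum>m\<in>S. fun_scale (r m) m)"
    unfolding cfun.span_explicit by blast
  obtain A where A: "A \<subseteq> ?Ms" "inj_on monom_fun A" "S = monom_fun ` A"
    using S(2) unfolding subset_image_inj by blast
  have finA: "finite A" using S(1) A(2) unfolding A(3) by (simp add: finite_image_iff)
  have F_eq: "F z = (\<Sum>\<mu>\<in>A. r (monom_fun \<mu>) * monom_fun \<mu> z)" for z
    unfolding FS A(3) by (simp add: sum.reindex[OF A(2)] sum_fun_apply fun_scale_def)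
  have "F (row_action k G z) = F (col_action k G z)" for z G
  proof (rule action_invariance_by_shifting[OF _ F_eq])
    show "set_mset \<mu> \<subseteq> coordinates k p q" if "\<mu> \<in> A" for \<mu> using A(1) that by blast
    fix t assume "(\<Sum>a<k. \<Sum>b<k. cmod (G (a, b))) < cmod t"
    then have g: "matrix_map (add_scalar G t) \<in> GL s" by (rule diagonally_dominant_GL)
    show "F (row_action k (add_scalar G t) z) = F (col_action k (add_scalar G t) z)"
      unfolding F_def GL_act_matrix_map_point[OF g, symmetric] by (rule inv[OF g point_in_mixed_space, symmetric])
  qed
  then have F_span: "F \<in> cfun.span (arc_fun k ` {D. bipartite_arc_diagram p q D \<and> 2 * size D = d})"
    by (intro arc_funs_span_invariants[OF finA _ F_eq]) (use A(1) in blast)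
  have f_eq: "f = on_space ?W (\<lambda>w. F (point_coords w))"
  proof
    fix w
    \<comment> \<open>polynomial functions are extended by zero, which makes them determined by their values on the mixed space\<close>
    have zero: "g w = 0" if "g \<in> hom_poly_funs (mixed_scale s) ?W d" "w \<notin> ?W" for g
      using that(1) unfolding hom_poly_funs_def
    proof (induction rule: cfun.span_induct_alt)
      case base then show ?case by simp
    next
      case (step c x y)
      then show ?case using that(2) by (auto simp: fun_scale_def on_space_def)
    qed
    show "f w = on_space ?W (\<lambda>w. F (point_coords w)) w"
      using zero[OF hom] by (cases "w \<in> ?W") (simp_all add: on_space_def F_def point_point_coords)
  qed
  have "arc_fun k ` {D. bipartite_arc_diagram p q D \<and> 2 * size D = d} \<subseteq> cfun.span (arc_fun k ` ?N)"
    by (auto intro!: arc_fun_straightening simp: total_degree_eq)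
  with F_span have "F \<in> cfun.span (arc_fun k ` ?N)"
    using cfun.span_mono[of _ "cfun.span (arc_fun k ` ?N)"] unfolding cfun.span_span by blast
  then have "on_space ?W (\<lambda>w. F (point_coords w)) \<in> cfun.span (diagram_fun s p q ` ?N)"
  proof (induction rule: cfun.span_induct_alt)
    case base
    have "on_space ?W (\<lambda>w. 0 (point_coords w)) = 0" by (simp add: fun_eq_iff on_space_def)
    then show ?case by (simp only: cfun.span_zero)
  next
    case (step c x y)
    then obtain D where D: "D \<in> ?N" "x = arc_fun k D" by blast
    then have "bipartite_arc_diagram p q D" by (simp add: nesting_bounded_diagrams_def)
    from diagram_fun_point[OF this]
    have x: "on_space ?W (\<lambda>w. x (point_coords w)) = diagram_fun s p q D"
      unfolding D(2) by (metis (no_types, lifting) ext diagram_fun_def on_space_def point_point_coords)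
    have "on_space ?W (\<lambda>w. (fun_scale c x + y) (point_coords w)) =
        fun_scale c (on_space ?W (\<lambda>w. x (point_coords w))) + on_space ?W (\<lambda>w. y (point_coords w))"
      by (simp add: fun_eq_iff on_space_def fun_scale_def)
    also have "\<dots> \<in> cfun.span (diagram_fun s p q ` ?N)"
      unfolding x by (rule cfun.span_add[OF cfun.span_scale[OF cfun.span_base[OF imageI[OF D(1)]]] step(2)])
    finally show ?case .
  qed
  then show ?thesis unfolding f_eq[symmetric] .
qed

lemma diagram_funs_independent:
  assumes S: "finite S" "S \<subseteq> nesting_bounded_diagrams k p q d"
    and zero: "(\<Sum>D\<in>S. fun_scale (c D) (diagram_fun s p q D)) = 0" and D: "D \<in> S"
  shows "c D = 0"
proof (rule arc_funs_independent[OF S _ D])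
  fix z
  have "(\<Sum>D\<in>S. c D * arc_fun k D z) = (\<Sum>D\<in>S. fun_scale (c D) (diagram_fun s p q D)) (point p q z)"
    unfolding sum_fun_apply fun_scale_def
  proof (rule sum.cong[OF refl])
    fix D assume "D \<in> S"
    then have "bipartite_arc_diagram p q D" using S(2) by (auto simp: nesting_bounded_diagrams_def)
    then show "c D * arc_fun k D z = c D * diagram_fun s p q D (point p q z)" by (simp only: diagram_fun_point)
  qed
  then show "(\<Sum>D\<in>S. c D * arc_fun k D z) = 0" by (simp only: zero zero_fun_apply)
qed

lemma diagram_fun_in_GL_invariants:
  assumes "D \<in> nesting_bounded_diagrams k p q d"
  shows "diagram_fun s p q D \<in> GL_invariants s p q d"
  unfolding GL_invariants_def
  using assms diagram_fun_hom_poly[of p q D d] diagram_fun_invariant[of _ _ p q D]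
  by (simp add: nesting_bounded_diagrams_def)

lemma subspace_GL_invariants: "cfun.subspace (GL_invariants s p q d)"
  unfolding cfun.subspace_def GL_invariants_def
  using cfun.span_zero cfun.span_add cfun.span_scale unfolding hom_poly_funs_def
  by (auto simp: fun_scale_def)

end

lemma cfun_family_independent:
  fixes f :: "'i \<Rightarrow> 'w \<Rightarrow> complex"
  assumes zero: "\<And>S c i. finite S \<Longrightarrow> S \<subseteq> N \<Longrightarrow> (\<Sum>i\<in>S. fun_scale (c i) (f i)) = 0 \<Longrightarrow> i \<in> S \<Longrightarrow> c i = 0"
  shows "inj_on f N" "cfun.independent (f ` N)"
proof -
  show "inj_on f N"
  proof (rule inj_onI, rule ccontr)
    fix i j assume ij: "i \<in> N" "j \<in> N" "f i = f j" "i \<noteq> j"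
    let ?c = "\<lambda>x. if x = i then 1 else - 1"
    have "(\<Sum>x\<in>{i, j}. fun_scale (?c x) (f x)) = 0"
      using ij by (auto simp: fun_eq_iff fun_scale_def)
    from zero[of "{i, j}" ?c i, OF _ _ this] ij show False by simp
  qed
  show "cfun.independent (f ` N)"
    unfolding cfun.independent_explicit_finite_subsets
  proof (intro allI impI ballI)
    fix S u x assume S: "S \<subseteq> f ` N" "finite S" and 0: "(\<Sum>v\<in>S. fun_scale (u v) v) = 0" and x: "x \<in> S"
    obtain A where A: "A \<subseteq> N" "inj_on f A" "S = f ` A"
      using S(1) unfolding subset_image_inj by blast
    then obtain i where i: "i \<in> A" "x = f i" using x by blast
    have "finite A" using S(2) A by (simp add: finite_image_iff)
    moreover have "(\<Sum>i\<in>A. fun_scale (u (f i)) (f i)) = 0"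
      using 0 unfolding A(3) by (simp add: sum.reindex[OF A(2)])
    ultimately show "u x = 0" using zero[of A "\<lambda>i. u (f i)" i] A(1) i by blast
  qed
qed

theorem proposition4p1p1:
  fixes s :: "complex \<Rightarrow> 'v::ab_group_add \<Rightarrow> 'v" and B :: "'v set" and k p q d :: nat
  assumes "finite_dimensional_vector_space s B"
    and "vector_space.dim s (UNIV :: 'v set) = k"
  shows "inj_on (diagram_fun s p q) (nesting_bounded_diagrams k p q d) \<and>
    cfun.independent (diagram_fun s p q ` nesting_bounded_diagrams k p q d) \<and>
    cfun.span (diagram_fun s p q ` nesting_bounded_diagrams k p q d) = GL_invariants s p q d"
proof -
  interpret V: finite_dimensional_vector_space s B by (rule assms(1))
  have "card B = k" using assms(2) V.dim_UNIV by simp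
  then obtain e where "bij_betw e {..<k} B"
    using ex_bij_betw_nat_finite[OF V.finite_Basis] by (auto simp: atLeast0LessThan)
  then interpret coordinatized_space s B k e by unfold_locales
  show ?thesis
  proof (intro conjI)
    show "inj_on (diagram_fun s p q) (nesting_bounded_diagrams k p q d)"
      by (rule cfun_family_independent(1)) (rule diagram_funs_independent)
    show "cfun.independent (diagram_fun s p q ` nesting_bounded_diagrams k p q d)"
      by (rule cfun_family_independent(2)) (rule diagram_funs_independent)
    show "cfun.span (diagram_fun s p q ` nesting_bounded_diagrams k p q d) = GL_invariants s p q d"
    proof
      show "cfun.span (diagram_fun s p q ` nesting_bounded_diagrams k p q d) \<subseteq> GL_invariants s p q d"
        by (rule cfun.span_minimal[OF _ subspace_GL_invariants]) (use diagram_fun_in_GL_invariants in blast)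
      show "GL_invariants s p q d \<subseteq> cfun.span (diagram_fun s p q ` nesting_bounded_diagrams k p q d)"
        using GL_invariant_in_diagram_span by blast
    qed
  qed
qed

end
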